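(* Let $(W,S)$ be a Coxeter system. If $\Gamma$ is a $W$-digraph and $\mathscr V(\Gamma)$ is finite, then the following hold. (i) If $\sigma$ is the automorphism of $\mathbb Q(u)$ determined by ${}^\sigma u=-1/u$, then $\chi_{\Gamma_{\mathrm{rev}}}(T_w)={}^\sigma\chi_\Gamma(T_{w^{-1}}^{-1})$ for all $w\in W$ (that is, $\sigma$ applied to the value $\chi_\Gamma(T_{w^{-1}}^{-1})$). (ii) If $n(s,t)<\infty$ for all $s,t\in S$ and $\Gamma$ is acyclic, then $\chi_{\Gamma_{\mathrm{rev}}}(T_w)=\varepsilon_w u_w\,\chi_\Gamma(T_w^{-1})$ for all $w\in W$.
   Context: Coxeter system: $W$ has presentation $\langle s\in S\mid (rs)^{n(r,s)}=e \text{ for } r,s\in S,\ n(r,s)<\infty\rangle$ with $n(s,s)=1$ and $1<n(r,s)=n(s,r)\le\infty$ for $r\ne s$; $\ell$ is the length function; $u_w=u^{2\ell(w)}$ and $\varepsilon_w=(-1)^{\ell(w)}$ for $w\in W$. Hecke algebra: $u$ is an indeterminate and $H$ is the $\mathbb Q(u)$-algebra with basis $\{T_w\mid w\in W\}$ satisfying, for $s\in S$, $T_sT_w=T_{sw}$ if $\ell(sw)>\ell(w)$ and $T_sT_w=u^2T_{sw}+(u^2-1)T_w$ if $\ell(sw)<\ell(w)$. Each $T_w$ is invertible in $H$. An $S$-labeled digraph is a directed multigraph $\Gamma$ with vertex set $\mathscr V(\Gamma)$ and edge set $\mathscr E(\Gamma)$, in which every edge is either solid or dashed and is labeled by an element of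 $S$ (written $\alpha\xrightarrow{s}\beta$ if solid, $\alpha\overset{s}{\dashrightarrow}\beta$ if dashed), such that $\Gamma$ has no loops and, for each $s\in S$, every vertex occurs in exactly one edge labeled $s$. Let $M(\Gamma)$ be the $\mathbb Q(u)$-vector space with basis $\mathscr V(\Gamma)$. For $s\in S$ let $\tau_s$ be the linear operator on $M(\Gamma)$ with, for each vertex $\alpha$ (where $\beta$ is the other endpoint of the edge labeled $s$ at $\alpha$): $\tau_s(\alpha)=\beta$ if the edge is $\alpha\xrightarrow{s}\beta$; $\tau_s(\alpha)=(u^2-1)\alpha+u^2\beta$ if it is $\beta\xrightarrow{s}\alpha$; $\tau_s(\alpha)=u\alpha+(u+1)\beta$ if it is $\alpha\overset{s}{\dashrightarrow}\beta$; $\tau_s(\alpha)=(u^2-u-1)\alpha+(u^2-u)\beta$ if it is $\beta\overset{s}{\dashrightarrow}\alpha$. An $S$-labeled digraph $\Gamma$ is a $W$-digraph if $T_s\mapsto\tau_s$ ($s\in S$) extends to a homomorphism of $\mathbb Q(u)$-algebras from $H$ to the algebra of all linear operators on $M(\Gamma)$; then $M(\Gamma)$ is an $H$-module, and when $\mathscr V(\Gamma)$ is finite $\chi_\Gamma$ denotes its character (the trace function $H\to\mathbb Q(u)$). $\Gamma_{\mathrm{rev}}$ is the $S$-labeled digraph obtained from $\Gamma$ by reversing the direction of all edges while keeping their types and labels; it is a $W$-digraph whenever $\Gamma$ is. $\Gamma$ is acyclic if it has no nonempty directed circuit (ignoring types and labels of edges). *)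

theory Defs
  imports
    "HOL-Algebra.Generated_Groups"
    "HOL-Computational_Algebra.Fraction_Field"
    "HOL-Computational_Algebra.Polynomial"
    "HOL-Library.Extended_Nat"
    "HOL-Library.FuncSet"
    "HOL-Library.Poly_Mapping"
    "Graph_Theory.Arc_Walk"
begin

section \<open>Group presentations and Coxeter systems\<close>

text \<open>
  A group word is a list of letters; the letter (s, True) stands for the generator s, the
  letter (s, False) for its formal inverse.
\<close>

type_synonym 'g group_word = "('g \<times> bool) list"

inductive presentation_equiv :: "'g set \<Rightarrow> 'g group_word set \<Rightarrow> 'g group_word \<Rightarrow> 'g group_word \<Rightarrow> bool"
  for S :: "'g set" and R :: "'g group_word set" where
  refl: "presentation_equiv S R x x"
| sym: "presentation_equiv S R x y \<Longrightarrow> presentation_equiv S R y x"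
| trans: "presentation_equiv S R x y \<Longrightarrow> presentation_equiv S R y z \<Longrightarrow> presentation_equiv S R x z"
| cancel: "s \<in> S \<Longrightarrow> presentation_equiv S R (x @ [(s, b), (s, \<not> b)] @ y) (x @ y)"
| relator: "r \<in> R \<Longrightarrow> presentation_equiv S R (x @ r @ y) (x @ y)"

definition word_value :: "('g, 'm) monoid_scheme \<Rightarrow> 'g group_word \<Rightarrow> 'g" where
  "word_value G x =
     foldr (\<lambda>(s, b) g. (if b then s else inv\<^bsub>G\<^esub> s) \<otimes>\<^bsub>G\<^esub> g) x \<one>\<^bsub>G\<^esub>"

text \<open>
  G has the presentation with generating set S (a subset of G) and relators R: the group of
  words over S modulo R maps isomorphically onto G.
\<close>

definition has_presentation :: "('g, 'm) monoid_scheme \<Rightarrow> 'g set \<Rightarrow> 'g group_word set \<Rightarrow> bool" where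
  "has_presentation G S R \<longleftrightarrow>
     group G \<and> S \<subseteq> carrier G \<and> generate G S = carrier G \<and>
     (\<forall>x y. fst ` set x \<subseteq> S \<longrightarrow> fst ` set y \<subseteq> S \<longrightarrow>
        (word_value G x = word_value G y \<longleftrightarrow> presentation_equiv S R x y))"

definition coxeter_relators :: "'g set \<Rightarrow> ('g \<Rightarrow> 'g \<Rightarrow> enat) \<Rightarrow> 'g group_word set" where
  "coxeter_relators S n =
     {concat (replicate k [(r, True), (s, True)]) | r s k. r \<in> S \<and> s \<in> S \<and> n r s = enat k}"

definition coxeter_system :: "('w, 'm) monoid_scheme \<Rightarrow> 'w set \<Rightarrow> ('w \<Rightarrow> 'w \<Rightarrow> enat) \<Rightarrow> bool" where
  "coxeter_system W S n \<longleftrightarrow>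
     (\<forall>s\<in>S. n s s = 1) \<and>
     (\<forall>r\<in>S. \<forall>s\<in>S. r \<noteq> s \<longrightarrow> 1 < n r s \<and> n r s = n s r) \<and>
     has_presentation W S (coxeter_relators S n)"

definition coxeter_length :: "('w, 'm) monoid_scheme \<Rightarrow> 'w set \<Rightarrow> 'w \<Rightarrow> nat" where
  "coxeter_length W S w =
     (LEAST k. \<exists>ss. set ss \<subseteq> S \<and> length ss = k \<and> foldr (\<otimes>\<^bsub>W\<^esub>) ss \<one>\<^bsub>W\<^esub> = w)"


section \<open>The Hecke algebra\<close>

type_synonym ratfun = "rat poly fract"

definition u :: ratfun where
  "u = Fraction_Field.Fract [:0, 1:] 1"

definition field_automorphism :: "('k::field \<Rightarrow> 'k) \<Rightarrow> bool" where
  "field_automorphism \<sigma> \<longleftrightarrow>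
     bij \<sigma> \<and> \<sigma> 1 = 1 \<and> (\<forall>x y. \<sigma> (x + y) = \<sigma> x + \<sigma> y) \<and> (\<forall>x y. \<sigma> (x * y) = \<sigma> x * \<sigma> y)"

text \<open>
  The unital associative algebra structure consists of the ring structure of the type 'h
  together with the scalar multiplication. The equation T 1 = 1 follows from the remaining
  axioms unless S is empty, where they would leave T 1 an arbitrary nonzero scalar.
\<close>

locale hecke_algebra = vector_space scale
  for scale :: "ratfun \<Rightarrow> 'h::ring_1 \<Rightarrow> 'h" +
  fixes W :: "('w, 'm) monoid_scheme" and S :: "'w set" and T :: "'w \<Rightarrow> 'h"
  assumes scale_mult_left: "scale c x * y = scale c (x * y)"
    and scale_mult_right: "x * scale c y = scale c (x * y)"
    and T_inj: "inj_on T (carrier W)"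
    and T_independent: "independent (T ` carrier W)"
    and T_span: "span (T ` carrier W) = UNIV"
    and T_one: "T \<one>\<^bsub>W\<^esub> = 1"
    and T_mult_longer: "\<lbrakk>s \<in> S; w \<in> carrier W; coxeter_length W S (s \<otimes>\<^bsub>W\<^esub> w) > coxeter_length W S w\<rbrakk>
           \<Longrightarrow> T s * T w = T (s \<otimes>\<^bsub>W\<^esub> w)"
    and T_mult_shorter: "\<lbrakk>s \<in> S; w \<in> carrier W; coxeter_length W S (s \<otimes>\<^bsub>W\<^esub> w) < coxeter_length W S w\<rbrakk>
           \<Longrightarrow> T s * T w = scale (u\<^sup>2) (T (s \<otimes>\<^bsub>W\<^esub> w)) + scale (u\<^sup>2 - 1) (T w)"

definition ring_inverse :: "'h::ring_1 \<Rightarrow> 'h" where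
  "ring_inverse x = (THE y. x * y = 1 \<and> y * x = 1)"


section \<open>Labeled digraphs\<close>

record ('s, 'v, 'e) labeled_digraph =
  digr :: "('v, 'e) pre_digraph"
  label :: "'e \<Rightarrow> 's"
  dashed :: "'e \<Rightarrow> bool"

abbreviation vertices :: "('s, 'v, 'e) labeled_digraph \<Rightarrow> 'v set" where
  "vertices \<Gamma> \<equiv> verts (digr \<Gamma>)"

definition edge_at :: "('s, 'v, 'e) labeled_digraph \<Rightarrow> 's \<Rightarrow> 'v \<Rightarrow> 'e \<Rightarrow> bool" where
  "edge_at \<Gamma> s \<alpha> e \<longleftrightarrow>
     e \<in> arcs (digr \<Gamma>) \<and> label \<Gamma> e = s \<and> (tail (digr \<Gamma>) e = \<alpha> \<or> head (digr \<Gamma>) e = \<alpha>)"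

definition S_labeled_digraph :: "'s set \<Rightarrow> ('s, 'v, 'e) labeled_digraph \<Rightarrow> bool" where
  "S_labeled_digraph S \<Gamma> \<longleftrightarrow>
     loopfree_digraph (digr \<Gamma>) \<and>
     label \<Gamma> ` arcs (digr \<Gamma>) \<subseteq> S \<and>
     (\<forall>s\<in>S. \<forall>\<alpha>\<in>vertices \<Gamma>. \<exists>!e. edge_at \<Gamma> s \<alpha> e)"

definition rev_digraph :: "('s, 'v, 'e) labeled_digraph \<Rightarrow> ('s, 'v, 'e) labeled_digraph" where
  "rev_digraph \<Gamma> =
     \<Gamma>\<lparr>digr := \<lparr>verts = verts (digr \<Gamma>), arcs = arcs (digr \<Gamma>),
                tail = head (digr \<Gamma>), head = tail (digr \<Gamma>)\<rparr>\<rparr>"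

definition acyclic_digraph :: "('s, 'v, 'e) labeled_digraph \<Rightarrow> bool" where
  "acyclic_digraph \<Gamma> \<longleftrightarrow> \<not> (\<exists>p. pre_digraph.cycle (digr \<Gamma>) p)"


section \<open>The space M and the operators tau\<close>

definition vscale :: "ratfun \<Rightarrow> ('v \<Rightarrow>\<^sub>0 ratfun) \<Rightarrow> ('v \<Rightarrow>\<^sub>0 ratfun)" where
  "vscale c x = Poly_Mapping.map ((*) c) x"

definition basis_vec :: "'v \<Rightarrow> ('v \<Rightarrow>\<^sub>0 ratfun)" where
  "basis_vec \<alpha> = Poly_Mapping.single \<alpha> 1"

definition M_space :: "('s, 'v, 'e) labeled_digraph \<Rightarrow> ('v \<Rightarrow>\<^sub>0 ratfun) set" where
  "M_space \<Gamma> = {x. Poly_Mapping.keys x \<subseteq> vertices \<Gamma>}"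

definition tau_vertex :: "('s, 'v, 'e) labeled_digraph \<Rightarrow> 's \<Rightarrow> 'v \<Rightarrow> ('v \<Rightarrow>\<^sub>0 ratfun)" where
  "tau_vertex \<Gamma> s \<alpha> =
     (let e = (THE e. edge_at \<Gamma> s \<alpha> e); t = tail (digr \<Gamma>) e; h = head (digr \<Gamma>) e in
      if \<not> dashed \<Gamma> e then
        (if \<alpha> = t then basis_vec h
         else vscale (u\<^sup>2 - 1) (basis_vec \<alpha>) + vscale (u\<^sup>2) (basis_vec t))
      else
        (if \<alpha> = t then vscale u (basis_vec \<alpha>) + vscale (u + 1) (basis_vec h)
         else vscale (u\<^sup>2 - u - 1) (basis_vec \<alpha>) + vscale (u\<^sup>2 - u) (basis_vec t)))"

definition tau :: "('s, 'v, 'e) labeled_digraph \<Rightarrow> 's \<Rightarrow> ('v \<Rightarrow>\<^sub>0 ratfun) \<Rightarrow> ('v \<Rightarrow>\<^sub>0 ratfun)" where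
  "tau \<Gamma> s x = (\<Sum>\<alpha>\<in>Poly_Mapping.keys x. vscale (Poly_Mapping.lookup x \<alpha>) (tau_vertex \<Gamma> s \<alpha>))"

text \<open>
  Operators on M are functions that are undefined outside M, so that operators agreeing on M
  are equal and a homomorphism into the algebra of operators is determined as a function.
\<close>

definition lin_operators ::
  "('s, 'v, 'e) labeled_digraph \<Rightarrow> (('v \<Rightarrow>\<^sub>0 ratfun) \<Rightarrow> ('v \<Rightarrow>\<^sub>0 ratfun)) set" where
  "lin_operators \<Gamma> =
     {\<phi> \<in> M_space \<Gamma> \<rightarrow>\<^sub>E M_space \<Gamma>.
        (\<forall>x\<in>M_space \<Gamma>. \<forall>y\<in>M_space \<Gamma>. \<phi> (x + y) = \<phi> x + \<phi> y) \<and>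
        (\<forall>c. \<forall>x\<in>M_space \<Gamma>. \<phi> (vscale c x) = vscale c (\<phi> x))}"

definition algebra_hom_to_operators ::
  "(ratfun \<Rightarrow> 'h::ring_1 \<Rightarrow> 'h) \<Rightarrow> ('s, 'v, 'e) labeled_digraph \<Rightarrow>
   ('h \<Rightarrow> ('v \<Rightarrow>\<^sub>0 ratfun) \<Rightarrow> ('v \<Rightarrow>\<^sub>0 ratfun)) \<Rightarrow> bool" where
  "algebra_hom_to_operators scale \<Gamma> \<rho> \<longleftrightarrow>
     (\<forall>a. \<rho> a \<in> lin_operators \<Gamma>) \<and>
     (\<forall>a b. \<rho> (a + b) = (\<lambda>x\<in>M_space \<Gamma>. \<rho> a x + \<rho> b x)) \<and>
     (\<forall>c a. \<rho> (scale c a) = (\<lambda>x\<in>M_space \<Gamma>. vscale c (\<rho> a x))) \<and>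
     \<rho> 1 = (\<lambda>x\<in>M_space \<Gamma>. x) \<and>
     (\<forall>a b. \<rho> (a * b) = compose (M_space \<Gamma>) (\<rho> a) (\<rho> b))"

definition extends_tau ::
  "(ratfun \<Rightarrow> 'h::ring_1 \<Rightarrow> 'h) \<Rightarrow> 's set \<Rightarrow> ('s \<Rightarrow> 'h) \<Rightarrow> ('s, 'v, 'e) labeled_digraph \<Rightarrow>
   ('h \<Rightarrow> ('v \<Rightarrow>\<^sub>0 ratfun) \<Rightarrow> ('v \<Rightarrow>\<^sub>0 ratfun)) \<Rightarrow> bool" where
  "extends_tau scale S T \<Gamma> \<rho> \<longleftrightarrow>
     algebra_hom_to_operators scale \<Gamma> \<rho> \<and> (\<forall>s\<in>S. \<rho> (T s) = restrict (tau \<Gamma> s) (M_space \<Gamma>))"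

definition W_digraph ::
  "(ratfun \<Rightarrow> 'h::ring_1 \<Rightarrow> 'h) \<Rightarrow> 's set \<Rightarrow> ('s \<Rightarrow> 'h) \<Rightarrow> ('s, 'v, 'e) labeled_digraph \<Rightarrow> bool" where
  "W_digraph scale S T \<Gamma> \<longleftrightarrow> S_labeled_digraph S \<Gamma> \<and> (\<exists>\<rho>. extends_tau scale S T \<Gamma> \<rho>)"

definition op_trace ::
  "('s, 'v, 'e) labeled_digraph \<Rightarrow> (('v \<Rightarrow>\<^sub>0 ratfun) \<Rightarrow> ('v \<Rightarrow>\<^sub>0 ratfun)) \<Rightarrow> ratfun" where
  "op_trace \<Gamma> \<phi> = (\<Sum>\<alpha>\<in>vertices \<Gamma>. Poly_Mapping.lookup (\<phi> (basis_vec \<alpha>)) \<alpha>)"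

text \<open>
  The homomorphism below is unique, since the T s generate the Hecke algebra; for a digraph
  that is not a W-digraph the value is meaningless.
\<close>

definition chi ::
  "(ratfun \<Rightarrow> 'h::ring_1 \<Rightarrow> 'h) \<Rightarrow> 's set \<Rightarrow> ('s \<Rightarrow> 'h) \<Rightarrow> ('s, 'v, 'e) labeled_digraph \<Rightarrow> 'h \<Rightarrow> ratfun" where
  "chi scale S T \<Gamma> a = op_trace \<Gamma> ((THE \<rho>. extends_tau scale S T \<Gamma> \<rho>) a)"

end

theory Submission
  imports Defs "HOL-Computational_Algebra.Polynomial_Factorial"
begin

text \<open>
  On the plane spanned by the two ends of an edge labeled \<open>s\<close>, the operator \<open>\<tau>\<^sub>s\<close> has the
  eigenvalues \<open>u\<^sup>2\<close> and \<open>- 1\<close>, whatever the type of the edge, so its inverse is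
  \<open>u\<^sup>-\<^sup>2 (\<tau>\<^sub>s - (u\<^sup>2 - 1))\<close>. Comparing \<open>2 \<times> 2\<close> matrices gives two descriptions of the operator
  \<open>\<tau>'\<^sub>s\<close> of the reversed digraph: entrywise \<open>\<tau>'\<^sub>s = \<sigma>(\<tau>\<^sub>s\<^sup>-\<^sup>1)\<close>, and
  \<open>\<tau>'\<^sub>s = D (- u\<^sup>2 \<tau>\<^sub>s\<^sup>-\<^sup>1)\<^sup>T D\<close> for any diagonal matrix \<open>D\<close> of signs that differ at the two ends
  of every edge (\<open>rev_edge_matrix_sigma\<close>, \<open>rev_edge_matrix_transpose\<close>). The first one extends
  from generators to \<open>T\<^sub>w\<close> as the image under \<open>\<sigma>\<close> of the inverse of \<open>T\<close> at \<open>w\<^sup>-\<^sup>1\<close>. In the second one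
  the transposition reverses products once more, which leads to the inverse of \<open>T\<^sub>w\<close> itself, with
  a factor \<open>- u\<^sup>2\<close> for every letter of \<open>w\<close>. Taking traces gives both formulas. That these families
  of matrices come from algebra homomorphisms follows from \<open>matrix_representation_exists\<close>.

  What remains is to find the signs, that is, to show that the underlying graph is bipartite if the
  digraph is acyclic and all \<open>n(s,t)\<close> are finite. The matrices of \<open>\<tau>\<^sub>s\<close> have entries in
  \<open>\<rat>[u]\<close>, and at \<open>u = 0\<close> they send the tail of an edge to its head and the head to its negative.
  Let \<open>\<alpha> \<rightarrow> \<beta>\<close> and \<open>\<alpha> \<rightarrow> \<gamma>\<close> be edges labeled \<open>s\<close> and \<open>t\<close>, and apply both sides of a braid relation
  \<open>\<dots> T\<^sub>t T\<^sub>s = \<dots> T\<^sub>s T\<^sub>t\<close> at \<open>u = 0\<close> to \<open>\<alpha>\<close>. Each side walks along a directed path, the first one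
  through \<open>\<beta>\<close> and the second one through \<open>\<gamma>\<close>, and the sign of the result records the parity of the
  length of the path. Hence the two paths meet and have equal parity (\<open>local_confluence\<close>), and by a
  version of Newman's lemma (\<open>parity_grading\<close>) the parity of the length of the paths from a vertex
  to a sink is well defined and changes along every edge. A braid relation is obtained from a folding
  argument inside the Hecke algebra (\<open>fold_condition\<close>, \<open>braid_relation\<close>).
\<close>

section \<open>Words and lengths in a Coxeter system\<close>

lemma presentation_equiv_even_length:
  assumes "presentation_equiv S R x y" and "\<And>r. r \<in> R \<Longrightarrow> even (length r)"
  shows "even (length x) \<longleftrightarrow> even (length y)"
  using assms by (induction rule: presentation_equiv.induct) auto

text \<open>
  The first argument counts the letters and the second one is the leftmost letter, so that the two
  sides of a braid relation are \<open>alt_word k s t\<close> and \<open>alt_word k t s\<close>.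
\<close>

fun alt_word :: "nat \<Rightarrow> 'a \<Rightarrow> 'a \<Rightarrow> 'a list" where
  "alt_word 0 s t = []"
| "alt_word (Suc k) s t = s # alt_word k t s"

lemma length_alt_word [simp]: "length (alt_word k s t) = k"
  by (induction k arbitrary: s t) auto

lemma set_alt_word: "set (alt_word k s t) \<subseteq> {s, t}"
  by (induction k arbitrary: s t) auto

lemma alt_word_Suc_right:
  "alt_word (Suc k) s t = alt_word k s t @ [if even k then s else t]"
proof (induction k arbitrary: s t)
  case (Suc k)
  have "alt_word (Suc (Suc k)) s t = s # alt_word (Suc k) t s" by simp
  also have "\<dots> = s # alt_word k t s @ [if even k then t else s]"
    using Suc.IH[of t s] by metis
  finally show ?case by simp
qed simp

lemma alt_word_even: "concat (replicate k [s, t]) = alt_word (2 * k) s t"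
  by (induction k) auto

locale coxeter_hecke = hecke_algebra scale W S T
  for scale :: "ratfun \<Rightarrow> 'h::ring_1 \<Rightarrow> 'h"
    and W :: "('w, 'm) monoid_scheme" and S :: "'w set" and T :: "'w \<Rightarrow> 'h" +
  fixes n :: "'w \<Rightarrow> 'w \<Rightarrow> enat"
  assumes coxeter: "coxeter_system W S n"
begin

abbreviation len :: "'w \<Rightarrow> nat" where
  "len \<equiv> coxeter_length W S"

abbreviation val :: "'w list \<Rightarrow> 'w" where
  "val ss \<equiv> foldr (\<otimes>\<^bsub>W\<^esub>) ss \<one>\<^bsub>W\<^esub>"

lemma presented: "has_presentation W S (coxeter_relators S n)"
  using coxeter unfolding coxeter_system_def by blast

sublocale grp: group W
  using presented unfolding has_presentation_def by blast

lemma S_carrier: "s \<in> S \<Longrightarrow> s \<in> carrier W"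
  using presented unfolding has_presentation_def by blast

lemma val_closed: "set ss \<subseteq> S \<Longrightarrow> val ss \<in> carrier W"
  by (induction ss) (auto simp: S_carrier)

lemma val_append:
  "set ss \<subseteq> S \<Longrightarrow> set ts \<subseteq> S \<Longrightarrow> val (ss @ ts) = val ss \<otimes>\<^bsub>W\<^esub> val ts"
  by (induction ss) (auto simp: S_carrier val_closed grp.m_assoc)

lemma word_value_positive: "word_value W (map (\<lambda>s. (s, True)) ss) = val ss"
  by (induction ss) (auto simp: word_value_def)

lemma val_eq_iff:
  assumes "set ss \<subseteq> S" "set ts \<subseteq> S"
  shows "val ss = val ts \<longleftrightarrow> presentation_equiv S (coxeter_relators S n)
           (map (\<lambda>s. (s, True)) ss) (map (\<lambda>s. (s, True)) ts)"
proof -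
  have "fst ` set (map (\<lambda>s. (s, True)) ss) \<subseteq> S" "fst ` set (map (\<lambda>s. (s, True)) ts) \<subseteq> S"
    using assms by auto
  then show ?thesis
    using presented unfolding has_presentation_def word_value_positive[symmetric] by blast
qed

text \<open>
  Every relator has even length, so the parity of the length of a word depends only on its value.
\<close>

lemma val_eq_parity:
  assumes "val ss = val ts" "set ss \<subseteq> S" "set ts \<subseteq> S"
  shows "even (length ss) \<longleftrightarrow> even (length ts)"
proof -
  have "even (length r)" if "r \<in> coxeter_relators S n" for r
    using that by (auto simp: coxeter_relators_def length_concat sum_list_replicate)
  then show ?thesis
    using presentation_equiv_even_length assms val_eq_iff[of ss ts] by (metis length_map)
qed

lemma val_relator:
  assumes "s \<in> S" "t \<in> S" "n s t = enat k"
  shows "val (alt_word (2 * k) s t) = \<one>\<^bsub>W\<^esub>"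
proof -
  let ?r = "concat (replicate k [(s, True), (t, True)])"
  have eq: "map (\<lambda>s. (s, True)) (alt_word (2 * k) s t) = ?r"
    by (simp add: alt_word_even[symmetric] map_concat map_replicate)
  have "?r \<in> coxeter_relators S n"
    using assms unfolding coxeter_relators_def by blast
  then have "presentation_equiv S (coxeter_relators S n) ?r []"
    using presentation_equiv.relator[of ?r _ S "[]" "[]"] by simp
  then have "val (alt_word (2 * k) s t) = val []"
    using val_eq_iff[of "alt_word (2 * k) s t" "[]"] eq set_alt_word[of "2 * k" s t] assms by auto
  then show ?thesis by simp
qed

lemma generator_square:
  assumes "s \<in> S" shows "s \<otimes>\<^bsub>W\<^esub> s = \<one>\<^bsub>W\<^esub>"
proof -
  have "n s s = enat 1"
    using coxeter assms unfolding coxeter_system_def by (simp add: one_enat_def)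
  then show ?thesis
    using val_relator[of s s 1] assms S_carrier by (simp add: numeral_2_eq_2)
qed

lemma generator_inv: "s \<in> S \<Longrightarrow> inv\<^bsub>W\<^esub> s = s"
  using generator_square S_carrier grp.inv_equality by blast

lemma generator_cancel:
  "s \<in> S \<Longrightarrow> w \<in> carrier W \<Longrightarrow> s \<otimes>\<^bsub>W\<^esub> (s \<otimes>\<^bsub>W\<^esub> w) = w"
  "s \<in> S \<Longrightarrow> w \<in> carrier W \<Longrightarrow> w \<otimes>\<^bsub>W\<^esub> s \<otimes>\<^bsub>W\<^esub> s = w"
  by (simp_all add: grp.m_assoc[symmetric] generator_square S_carrier)
     (simp add: grp.m_assoc generator_square S_carrier)

lemma word_exists:
  assumes "w \<in> carrier W" shows "\<exists>ss. set ss \<subseteq> S \<and> val ss = w"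
proof -
  have "w \<in> generate W S"
    using assms presented unfolding has_presentation_def by blast
  then show ?thesis
  proof (induction rule: generate.induct)
    case one
    show ?case by (rule exI[of _ "[]"]) simp
  next
    case (incl h)
    then show ?case by (intro exI[of _ "[h]"]) (simp add: S_carrier)
  next
    case (inv h)
    then show ?case by (intro exI[of _ "[h]"]) (simp add: S_carrier generator_inv)
  next
    case (eng h1 h2)
    then obtain ss ts where "set ss \<subseteq> S" "val ss = h1" "set ts \<subseteq> S" "val ts = h2" by blast
    then show ?case by (intro exI[of _ "ss @ ts"]) (use val_append in auto)
  qed
qed

lemma len_val_le: "set ss \<subseteq> S \<Longrightarrow> len (val ss) \<le> length ss"
  unfolding coxeter_length_def by (rule Least_le) blast

lemma reduced_word:
  assumes "w \<in> carrier W"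
  obtains ss where "set ss \<subseteq> S" "length ss = len w" "val ss = w"
proof -
  have "\<exists>k ss. set ss \<subseteq> S \<and> length ss = k \<and> val ss = w"
    using word_exists[OF assms] by blast
  from LeastI_ex[OF this] show thesis
    using that unfolding coxeter_length_def by blast
qed

lemma len_parity:
  assumes "set ss \<subseteq> S" shows "even (len (val ss)) \<longleftrightarrow> even (length ss)"
proof -
  obtain ts where "set ts \<subseteq> S" "length ts = len (val ss)" "val ts = val ss"
    using reduced_word[OF val_closed[OF assms]] .
  then show ?thesis using val_eq_parity[of ts ss] assms by simp
qed

lemma len_one: "len \<one>\<^bsub>W\<^esub> = 0"
  using len_val_le[of "[]"] by simp

lemma len_generator: "s \<in> S \<Longrightarrow> len s = 1"
  using len_val_le[of "[s]"] len_parity[of "[s]"] S_carrier[of s]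
  by (cases "len s") auto

lemma len_inv_le:
  assumes "w \<in> carrier W" shows "len (inv\<^bsub>W\<^esub> w) \<le> len w"
proof -
  have *: "inv\<^bsub>W\<^esub> (val ss) = val (rev ss)" if "set ss \<subseteq> S" for ss
    using that
  proof (induction ss)
    case (Cons s ss)
    then have "inv\<^bsub>W\<^esub> (val (s # ss)) = val (rev ss) \<otimes>\<^bsub>W\<^esub> val [s]"
      by (simp add: grp.inv_mult_group S_carrier val_closed generator_inv)
    also have "\<dots> = val (rev (s # ss))"
      using Cons.prems val_append[of "rev ss" "[s]"] by simp
    finally show ?case .
  qed simp
  obtain ss where "set ss \<subseteq> S" "length ss = len w" "val ss = w"
    using reduced_word[OF assms] .
  then show ?thesis using *[of ss] len_val_le[of "rev ss"] by simp
qed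

lemma len_inv: "w \<in> carrier W \<Longrightarrow> len (inv\<^bsub>W\<^esub> w) = len w"
  using len_inv_le[of w] len_inv_le[of "inv\<^bsub>W\<^esub> w"] by simp

lemma len_generator_mult_le:
  assumes "s \<in> S" "w \<in> carrier W" shows "len (s \<otimes>\<^bsub>W\<^esub> w) \<le> Suc (len w)"
proof -
  obtain ss where "set ss \<subseteq> S" "length ss = len w" "val ss = w"
    using reduced_word[OF assms(2)] .
  then show ?thesis using len_val_le[of "s # ss"] assms(1) by simp
qed

lemma len_generator_mult:
  assumes "s \<in> S" "w \<in> carrier W"
  shows "len (s \<otimes>\<^bsub>W\<^esub> w) = Suc (len w) \<or> len w = Suc (len (s \<otimes>\<^bsub>W\<^esub> w))"
proof -
  obtain ss where ss: "set ss \<subseteq> S" "length ss = len w" "val ss = w"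
    using reduced_word[OF assms(2)] .
  have "even (len (s \<otimes>\<^bsub>W\<^esub> w)) \<noteq> even (len w)"
    using len_parity[of "s # ss"] ss assms(1) by auto
  moreover have "len w \<le> Suc (len (s \<otimes>\<^bsub>W\<^esub> w))"
    using len_generator_mult_le[of s "s \<otimes>\<^bsub>W\<^esub> w"] assms by (simp add: generator_cancel S_carrier)
  ultimately show ?thesis
    using len_generator_mult_le[OF assms] by (cases "len w = len (s \<otimes>\<^bsub>W\<^esub> w)") auto
qed

text \<open>
  Induction along a reduced word, read from the right: every step multiplies by a generator on the
  left and increases the length, which is the case where the basis elements multiply.
\<close>

lemma carrier_induct [consumes 1, case_names one step]:
  assumes "w \<in> carrier W" and "P \<one>\<^bsub>W\<^esub>"
    and "\<And>s w. s \<in> S \<Longrightarrow> w \<in> carrier W \<Longrightarrow> len (s \<otimes>\<^bsub>W\<^esub> w) = Suc (len w) \<Longrightarrow> P w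
           \<Longrightarrow> P (s \<otimes>\<^bsub>W\<^esub> w)"
  shows "P w"
  using assms(1)
proof (induction "len w" arbitrary: w rule: less_induct)
  case less
  obtain ss where ss: "set ss \<subseteq> S" "length ss = len w" "val ss = w"
    using reduced_word[OF less.prems] .
  show ?case
  proof (cases ss)
    case Nil
    then show ?thesis using ss assms(2) by simp
  next
    case (Cons s ts)
    have sv: "s \<in> S" "val ts \<in> carrier W" "w = s \<otimes>\<^bsub>W\<^esub> val ts" "len (val ts) \<le> length ts"
      using ss Cons val_closed len_val_le by auto
    then have "len w = Suc (len (val ts))"
      using len_generator_mult_le[of s "val ts"] ss(2) Cons by simp
    then show ?thesis using less.hyps[of "val ts"] assms(3)[of s "val ts"] sv by simp
  qed
qed


section \<open>Products of standard basis elements\<close>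

text \<open>
  Right factors of reduced words are reduced, so the first multiplication rule applies at
  every letter.
\<close>

lemma T_reduced_word:
  assumes "set ss \<subseteq> S" "len (val ss) = length ss"
  shows "T (val ss) = prod_list (map T ss)"
  using assms
proof (induction ss)
  case Nil
  then show ?case by (simp add: T_one)
next
  case (Cons s ss)
  have v: "s \<in> S" "val ss \<in> carrier W" "len (val ss) \<le> length ss"
    using Cons.prems val_closed len_val_le by auto
  then have l: "len (val ss) = length ss"
    using len_generator_mult_le[of s "val ss"] Cons.prems by simp
  then have "T s * T (val ss) = T (s \<otimes>\<^bsub>W\<^esub> val ss)"
    using v Cons.prems by (intro T_mult_longer) auto
  then show ?case using Cons l by simp
qed

text \<open>
  The defining rules only describe multiplication from the left; appending a letter to a reduced
  word gives the corresponding rule on the right.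
\<close>

lemma T_mult_right:
  assumes "w \<in> carrier W" "s \<in> S" "len (w \<otimes>\<^bsub>W\<^esub> s) = Suc (len w)"
  shows "T (w \<otimes>\<^bsub>W\<^esub> s) = T w * T s"
proof -
  obtain ss where ss: "set ss \<subseteq> S" "length ss = len w" "val ss = w"
    using reduced_word[OF assms(1)] .
  then have "val (ss @ [s]) = w \<otimes>\<^bsub>W\<^esub> s"
    using assms val_append[of ss "[s]"] S_carrier by simp
  then show ?thesis
    using T_reduced_word[of "ss @ [s]"] T_reduced_word[of ss] ss assms by simp
qed

lemma T_quadratic:
  assumes "s \<in> S" shows "T s * T s = scale (u\<^sup>2) 1 + scale (u\<^sup>2 - 1) (T s)"
  using T_mult_shorter[of s s] assms
  by (simp add: generator_square S_carrier len_one len_generator T_one)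

lemma u_not_0: "u \<noteq> 0"
  by (simp add: u_def Zero_fract_def eq_fract)

lemma u_square_not_1: "u\<^sup>2 \<noteq> 1"
  by (simp add: u_def power2_eq_square One_fract_def eq_fract one_pCons)

text \<open>
  A folding argument: evaluate the product of the three basis elements for \<open>s\<close>, \<open>w\<close>, \<open>t\<close> in
  both ways. One bracketing leaves the basis element of \<open>w t\<close> with coefficient
  \<open>u\<^sup>2 - 1\<close>, the other that of \<open>s w\<close>. This is the folding form of the exchange condition, obtained
  from the associativity of the algebra instead of from the geometry of \<open>W\<close>.
\<close>

lemma fold_condition:
  assumes st: "s \<in> S" "t \<in> S" and w: "w \<in> carrier W"
    and "len (s \<otimes>\<^bsub>W\<^esub> w) = Suc (len w)" "len (w \<otimes>\<^bsub>W\<^esub> t) = Suc (len w)"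
    and "len (s \<otimes>\<^bsub>W\<^esub> w \<otimes>\<^bsub>W\<^esub> t) < len (w \<otimes>\<^bsub>W\<^esub> t)"
  shows "s \<otimes>\<^bsub>W\<^esub> w = w \<otimes>\<^bsub>W\<^esub> t"
proof -
  define y where "y = s \<otimes>\<^bsub>W\<^esub> w \<otimes>\<^bsub>W\<^esub> t"
  have c: "s \<in> carrier W" "t \<in> carrier W" "y \<in> carrier W" "w \<otimes>\<^bsub>W\<^esub> t \<in> carrier W"
    "s \<otimes>\<^bsub>W\<^esub> w \<in> carrier W"
    using st w by (auto simp: S_carrier y_def)
  have y: "s \<otimes>\<^bsub>W\<^esub> (w \<otimes>\<^bsub>W\<^esub> t) = y" "y \<otimes>\<^bsub>W\<^esub> t = s \<otimes>\<^bsub>W\<^esub> w"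
    using c w st by (auto simp: y_def grp.m_assoc generator_square)
  have "len y = len w"
    using len_generator_mult[OF st(1) c(4)] assms(5,6) unfolding y(1) y_def[symmetric] by auto
  then have yt: "T (s \<otimes>\<^bsub>W\<^esub> w) = T y * T t"
    using T_mult_right[of y t] c st assms(4) y by simp
  have "T s * T (w \<otimes>\<^bsub>W\<^esub> t) = scale (u\<^sup>2) (T y) + scale (u\<^sup>2 - 1) (T (w \<otimes>\<^bsub>W\<^esub> t))"
    using T_mult_shorter[OF st(1) c(4)] assms(6) y by (simp add: y_def)
  moreover have "T s * T (w \<otimes>\<^bsub>W\<^esub> t) = scale (u\<^sup>2) (T y) + scale (u\<^sup>2 - 1) (T (s \<otimes>\<^bsub>W\<^esub> w))"
  proof -
    have "T s * T (w \<otimes>\<^bsub>W\<^esub> t) = T s * T w * T t"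
      using T_mult_right[OF w st(2) assms(5)] by (simp add: mult.assoc)
    also have "\<dots> = T y * (T t * T t)"
      using T_mult_longer[OF st(1) w] assms(4) yt by (simp add: mult.assoc)
    also have "\<dots> = scale (u\<^sup>2) (T y) + scale (u\<^sup>2 - 1) (T y * T t)"
      using st(2) by (simp add: T_quadratic distrib_left scale_mult_right)
    finally show ?thesis using yt by simp
  qed
  ultimately have "scale (u\<^sup>2 - 1) (T (w \<otimes>\<^bsub>W\<^esub> t)) = scale (u\<^sup>2 - 1) (T (s \<otimes>\<^bsub>W\<^esub> w))"
    by (metis add_left_cancel)
  then have "T (w \<otimes>\<^bsub>W\<^esub> t) = T (s \<otimes>\<^bsub>W\<^esub> w)"
    using u_square_not_1 by (metis right_minus_eq scale_cancel_left)
  then show ?thesis using T_inj c by (metis inj_onD)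
qed

text \<open>
  Since \<open>st\<close> has finite order, there is a \<open>k\<close> such that both alternating words of length \<open>k\<close> are
  reduced, but one of those of length \<open>k + 1\<close> is not. So extending one of the reduced words by a
  letter shortens it, and the folding condition identifies the two words of length \<open>k\<close>.
\<close>

lemma braid_relation:
  assumes st: "s \<in> S" "t \<in> S" "s \<noteq> t" and fin: "n s t < \<infinity>"
  shows "\<exists>k. prod_list (map T (alt_word (Suc k) s t)) = prod_list (map T (alt_word (Suc k) t s))"
proof -
  define red where
    "red j \<longleftrightarrow> len (val (alt_word j s t)) = j \<and> len (val (alt_word j t s)) = j" for j
  obtain m where m: "n s t = enat m" using fin by auto
  have "1 < n s t" using coxeter st unfolding coxeter_system_def by blast
  then have "0 < m" using m by (simp add: one_enat_def)
  then have "\<not> red (2 * m)"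
    using val_relator[OF st(1,2) m] len_one by (auto simp: red_def)
  moreover have "red 0" by (simp add: red_def len_one)
  ultimately obtain k where k: "red k" "\<not> red (Suc k)"
    using nat_induct[of red "2 * m"] by blast
  have "red 1" using st by (simp add: red_def S_carrier len_generator)
  then obtain i where i: "k = Suc i" using k by (cases k) auto
  \<comment> \<open>The two letters play symmetric roles, so only one failing extension is treated.\<close>
  have main: "val (alt_word k p q) = val (alt_word k q p)"
    if p: "p \<in> S" "q \<in> S" and r: "len (val (alt_word k p q)) = k" "len (val (alt_word k q p)) = k"
      and nr: "len (val (alt_word (Suc k) q p)) \<noteq> Suc k" for p q
  proof -
    have sub: "set (alt_word j p q) \<subseteq> S" "set (alt_word j q p) \<subseteq> S" for j
      using p set_alt_word[of j p q] set_alt_word[of j q p] by auto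
    define x where "x = (if even i then p else q)"
    define w where "w = val (alt_word i p q)"
    have x: "x \<in> S" using p by (simp add: x_def)
    have w: "w \<in> carrier W" unfolding w_def using val_closed sub by blast
    have wx: "val (alt_word k p q) = w \<otimes>\<^bsub>W\<^esub> x"
      using val_append[of "alt_word i p q" "[x]"] sub x S_carrier
      unfolding i alt_word_Suc_right w_def x_def by auto
    have qw: "val (alt_word k q p) = q \<otimes>\<^bsub>W\<^esub> w"
      by (simp add: i w_def)
    have qwx: "val (alt_word (Suc k) q p) = q \<otimes>\<^bsub>W\<^esub> w \<otimes>\<^bsub>W\<^esub> x"
      using wx x w p S_carrier by (simp add: grp.m_assoc)
    have "len w \<le> i" using len_val_le[of "alt_word i p q"] sub by (simp add: w_def)
    moreover have "k \<le> Suc (len w)"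
      using len_generator_mult_le[OF p(2) w] r qw by simp
    ultimately have lw: "len w = i" by (simp add: i)
    have "len (q \<otimes>\<^bsub>W\<^esub> w \<otimes>\<^bsub>W\<^esub> x) < k"
      using len_generator_mult[of q "w \<otimes>\<^bsub>W\<^esub> x"] nr r wx qwx p w x S_carrier
      by (auto simp: grp.m_assoc)
    then have "q \<otimes>\<^bsub>W\<^esub> w = w \<otimes>\<^bsub>W\<^esub> x"
      using fold_condition[OF p(2) x w] r wx qw lw i by simp
    then show ?thesis using wx qw by simp
  qed
  have "val (alt_word k s t) = val (alt_word k t s)"
    using main[of s t] main[of t s] k st unfolding red_def by metis
  moreover have "set (alt_word k s t) \<subseteq> S" "set (alt_word k t s) \<subseteq> S"
    using st set_alt_word[of k s t] set_alt_word[of k t s] by auto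
  ultimately show ?thesis
    using T_reduced_word[of "alt_word k s t"] T_reduced_word[of "alt_word k t s"] k(1) i
    by (metis length_alt_word red_def)
qed

end

section \<open>Matrices indexed by a finite set\<close>

definition mat_mult :: "'v set \<Rightarrow> ('v \<Rightarrow> 'v \<Rightarrow> 'a::comm_ring_1) \<Rightarrow> ('v \<Rightarrow> 'v \<Rightarrow> 'a) \<Rightarrow> 'v \<Rightarrow> 'v \<Rightarrow> 'a" where
  "mat_mult V A B i j = (\<Sum>k\<in>V. A i k * B k j)"

definition mat_one :: "'v \<Rightarrow> 'v \<Rightarrow> 'a::comm_ring_1" where
  "mat_one i j = (if i = j then 1 else 0)"

lemma mat_mult_assoc:
  "mat_mult V (mat_mult V A B) C i j = mat_mult V A (mat_mult V B C) i j"
proof -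
  have "mat_mult V (mat_mult V A B) C i j = (\<Sum>k\<in>V. \<Sum>l\<in>V. A i l * B l k * C k j)"
    by (simp add: mat_mult_def sum_distrib_right)
  also have "\<dots> = (\<Sum>l\<in>V. \<Sum>k\<in>V. A i l * B l k * C k j)"
    by (rule sum.swap)
  finally show ?thesis
    by (simp add: mat_mult_def sum_distrib_left mult.assoc)
qed

lemma mat_mult_one_left: "finite V \<Longrightarrow> i \<in> V \<Longrightarrow> mat_mult V mat_one A i j = A i j"
  by (simp add: mat_mult_def mat_one_def if_distrib[of "\<lambda>x. x * _"] cong: if_cong)

lemma mat_mult_cong:
  assumes "\<And>k. k \<in> V \<Longrightarrow> A i k = A' i k" "\<And>k. k \<in> V \<Longrightarrow> B k j = B' k j"
  shows "mat_mult V A B i j = mat_mult V A' B' i j"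
  using assms by (simp add: mat_mult_def)

lemma mat_mult_linear_left:
  "mat_mult V (\<lambda>i j. c * A i j + B i j) C i j = c * mat_mult V A C i j + mat_mult V B C i j"
  by (simp only: mat_mult_def distrib_right sum.distrib sum_distrib_left mult.assoc)

lemma mat_mult_linear_right:
  "mat_mult V A (\<lambda>i j. c * B i j + C i j) i j = c * mat_mult V A B i j + mat_mult V A C i j"
  by (simp only: mat_mult_def distrib_left sum.distrib sum_distrib_left mult.left_commute)

text \<open>
  Matrices are total functions of their indices, and only the entries with both indices in the
  finite set \<open>V\<close> are meaningful; hence the restriction of all the equations to \<open>V\<close>.
\<close>

definition matrix_representation ::
  "(ratfun \<Rightarrow> 'h::ring_1 \<Rightarrow> 'h) \<Rightarrow> 'v set \<Rightarrow> ('h \<Rightarrow> 'v \<Rightarrow> 'v \<Rightarrow> ratfun) \<Rightarrow> bool" where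
  "matrix_representation scale V R \<longleftrightarrow>
     (\<forall>i\<in>V. \<forall>j\<in>V.
        (\<forall>a b. R (a + b) i j = R a i j + R b i j) \<and>
        (\<forall>c a. R (scale c a) i j = c * R a i j) \<and>
        R 1 i j = mat_one i j \<and>
        (\<forall>a b. R (a * b) i j = mat_mult V (R a) (R b) i j))"

lemma matrix_representationD:
  assumes "matrix_representation scale V R" "i \<in> V" "j \<in> V"
  shows "R (a + b) i j = R a i j + R b i j" "R (scale c a) i j = c * R a i j"
    "R 1 i j = mat_one i j" "R (a * b) i j = mat_mult V (R a) (R b) i j"
  using assms unfolding matrix_representation_def by blast+

context coxeter_hecke
begin

lemma T_span_induct [case_names zero step]:
  assumes "P 0" "\<And>c w a. w \<in> carrier W \<Longrightarrow> P a \<Longrightarrow> P (scale c (T w) + a)"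
  shows "P a"
proof -
  have "a \<in> span (T ` carrier W)" using T_span by simp
  then show ?thesis
    by (induction rule: span_induct_alt) (use assms in auto)
qed

text \<open>
  The linear extension of a family of matrices indexed by \<open>W\<close> is multiplicative as soon as the
  family obeys the two defining rules of the algebra, because left multiplication by a generator
  on the standard basis involves only these rules.
\<close>

lemma matrix_representation_exists:
  fixes V :: "'v set" and Q :: "'w \<Rightarrow> 'v \<Rightarrow> 'v \<Rightarrow> ratfun"
  assumes V: "finite V"
    and one: "\<And>i j. i \<in> V \<Longrightarrow> j \<in> V \<Longrightarrow> Q \<one>\<^bsub>W\<^esub> i j = mat_one i j"
    and step: "\<And>s w i j. s \<in> S \<Longrightarrow> w \<in> carrier W \<Longrightarrow> len (s \<otimes>\<^bsub>W\<^esub> w) = Suc (len w) \<Longrightarrow>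
        i \<in> V \<Longrightarrow> j \<in> V \<Longrightarrow> Q (s \<otimes>\<^bsub>W\<^esub> w) i j = mat_mult V (Q s) (Q w) i j"
    and quad: "\<And>s i j. s \<in> S \<Longrightarrow> i \<in> V \<Longrightarrow> j \<in> V \<Longrightarrow>
        mat_mult V (Q s) (Q s) i j = u\<^sup>2 * mat_one i j + (u\<^sup>2 - 1) * Q s i j"
  obtains R where "matrix_representation scale V R"
    and "\<And>w. w \<in> carrier W \<Longrightarrow> R (T w) = Q w"
proof -
  interpret vp: vector_space_pair scale "(*) :: ratfun \<Rightarrow> ratfun \<Rightarrow> ratfun"
    by unfold_locales (auto simp: algebra_simps)
  \<comment> \<open>The matrix entries are extended one at a time, as linear functionals.\<close>
  define R where
    "R a i j = vp.construct (T ` carrier W) (\<lambda>x. Q (inv_into (carrier W) T x) i j) a" for a i j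
  have lin: "Vector_Spaces.linear scale (*) (\<lambda>a. R a i j)" for i j
    unfolding R_def using vp.linear_construct[OF T_independent] .
  have R_T: "R (T w) = Q w" if "w \<in> carrier W" for w
    using that vp.construct_basis[OF T_independent] T_inj by (simp add: R_def fun_eq_iff)
  have R_add: "R (a + b) i j = R a i j + R b i j"
    and R_scale: "R (scale c a) i j = c * R a i j" and R_0: "R 0 i j = 0" for a b c i j
    using vp.linear_add[OF lin] vp.linear_scale[OF lin] vp.linear_0[OF lin] by auto
  have R_linear: "R (scale c a + b) = (\<lambda>i j. c * R a i j + R b i j)" for a b c
    by (simp add: R_add R_scale fun_eq_iff)
  have R_one: "R 1 i j = mat_one i j" if "i \<in> V" "j \<in> V" for i j
    using R_T[of "\<one>\<^bsub>W\<^esub>"] one that by (simp add: T_one)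
  have R_generator_basis: "R (T s * T v) i j = mat_mult V (Q s) (Q v) i j"
    if s: "s \<in> S" and v: "v \<in> carrier W" and ij: "i \<in> V" "j \<in> V" for s v i j
    using len_generator_mult[OF s v]
  proof
    assume "len (s \<otimes>\<^bsub>W\<^esub> v) = Suc (len v)"
    then show ?thesis
      using T_mult_longer[OF s v] step[OF s v] R_T[of "s \<otimes>\<^bsub>W\<^esub> v"] s v ij S_carrier by simp
  next
    assume l: "len v = Suc (len (s \<otimes>\<^bsub>W\<^esub> v))"
    define v' where "v' = s \<otimes>\<^bsub>W\<^esub> v"
    have v': "v' \<in> carrier W" "s \<otimes>\<^bsub>W\<^esub> v' = v"
      using s v by (auto simp: v'_def S_carrier generator_cancel)
    have Qv: "Q v k j = mat_mult V (Q s) (Q v') k j" if "k \<in> V" for k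
      using step[OF s v'(1), of k j] that ij l v' by (simp add: v'_def)
    have "mat_mult V (Q s) (Q v) i j = mat_mult V (Q s) (mat_mult V (Q s) (Q v')) i j"
      by (rule mat_mult_cong) (simp_all add: Qv)
    also have "\<dots> = mat_mult V (mat_mult V (Q s) (Q s)) (Q v') i j"
      by (simp add: mat_mult_assoc)
    also have "\<dots> = mat_mult V (\<lambda>i j. u\<^sup>2 * mat_one i j + (u\<^sup>2 - 1) * Q s i j) (Q v') i j"
      by (rule mat_mult_cong) (simp_all add: quad s ij)
    also have "\<dots> = u\<^sup>2 * mat_mult V mat_one (Q v') i j + (u\<^sup>2 - 1) * mat_mult V (Q s) (Q v') i j"
      by (simp only: mat_mult_def distrib_right sum.distrib sum_distrib_left mult.assoc)
    also have "\<dots> = u\<^sup>2 * Q v' i j + (u\<^sup>2 - 1) * Q v i j"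
      using Qv ij V by (simp add: mat_mult_one_left)
    also have "\<dots> = R (T s * T v) i j"
      using T_mult_shorter[OF s v] l R_T[of v] R_T[of v'] v v' by (simp add: R_add R_scale v'_def)
    finally show ?thesis ..
  qed
  have R_generator: "R (T s * b) i j = mat_mult V (R (T s)) (R b) i j"
    if s: "s \<in> S" and ij: "i \<in> V" "j \<in> V" for s b i j
  proof (induction b rule: T_span_induct)
    case zero
    then show ?case by (simp add: R_0 mat_mult_def)
  next
    case (step c w a)
    have "R (T s * (scale c (T w) + a)) i j
        = c * mat_mult V (R (T s)) (R (T w)) i j + mat_mult V (R (T s)) (R a) i j"
      using R_generator_basis[OF s step(1) ij] step(2) R_T[OF step(1)] R_T[OF S_carrier[OF s]]
      by (simp only: distrib_left scale_mult_right R_add R_scale)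
    then show ?case by (simp only: mat_mult_linear_right R_linear)
  qed
  have R_basis: "R (T w * b) i j = mat_mult V (R (T w)) (R b) i j"
    if "w \<in> carrier W" and ij: "i \<in> V" "j \<in> V" for w b i j
    using that
  proof (induction arbitrary: i j b rule: carrier_induct)
    case one
    then have "mat_mult V (R 1) (R b) i j = mat_mult V mat_one (R b) i j"
      by (intro mat_mult_cong) (simp_all add: R_one)
    then show ?case using one V by (simp add: T_one mat_mult_one_left)
  next
    case (step s w)
    have "R (T (s \<otimes>\<^bsub>W\<^esub> w) * b) i j = R (T s * (T w * b)) i j"
      using T_mult_longer[OF step(1,2)] step(3) by (simp add: mult.assoc[symmetric])
    also have "\<dots> = mat_mult V (R (T s)) (mat_mult V (R (T w)) (R b)) i j"
      unfolding R_generator[OF step(1,5,6)]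
      by (rule mat_mult_cong) (use step.IH step.prems in blast)+
    also have "\<dots> = mat_mult V (mat_mult V (R (T s)) (R (T w))) (R b) i j"
      by (simp add: mat_mult_assoc)
    also have "\<dots> = mat_mult V (R (T (s \<otimes>\<^bsub>W\<^esub> w))) (R b) i j"
    proof (rule mat_mult_cong)
      fix k assume "k \<in> V"
      then show "mat_mult V (R (T s)) (R (T w)) i k = R (T (s \<otimes>\<^bsub>W\<^esub> w)) i k"
        using R_generator[OF step(1), of i k "T w"] T_mult_longer[OF step(1,2)] step(3,5) by simp
    qed simp
    finally show ?case .
  qed
  have "R (a * b) i j = mat_mult V (R a) (R b) i j" if ij: "i \<in> V" "j \<in> V" for a b i j
  proof (induction a rule: T_span_induct)
    case zero
    then show ?case by (simp add: R_0 mat_mult_def)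
  next
    case (step c w a)
    have "R ((scale c (T w) + a) * b) i j
        = c * mat_mult V (R (T w)) (R b) i j + mat_mult V (R a) (R b) i j"
      using R_basis[OF step(1) ij, of b] step(2)
      by (simp only: distrib_right scale_mult_left R_add R_scale)
    then show ?case by (simp only: mat_mult_linear_left R_linear)
  qed
  then have "matrix_representation scale V R"
    unfolding matrix_representation_def using R_add R_scale R_one by blast
  then show thesis using that R_T by blast
qed

end


section \<open>The operators of a labeled digraph as matrices\<close>

text \<open>
  The coefficients of a vertex and of its neighbour in the image of that vertex under
  \<open>\<tau>\<^sub>s\<close>, according to the type of the edge and to whether the vertex is its tail.
\<close>

definition edge_diag :: "'a::comm_ring_1 \<Rightarrow> bool \<Rightarrow> bool \<Rightarrow> 'a" where
  "edge_diag x is_dashed outgoing =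
     (if is_dashed then (if outgoing then x else x\<^sup>2 - x - 1)
      else (if outgoing then 0 else x\<^sup>2 - 1))"

definition edge_off :: "'a::comm_ring_1 \<Rightarrow> bool \<Rightarrow> bool \<Rightarrow> 'a" where
  "edge_off x is_dashed outgoing =
     (if is_dashed then (if outgoing then x + 1 else x\<^sup>2 - x)
      else (if outgoing then 1 else x\<^sup>2))"

definition the_edge :: "('s, 'v, 'e) labeled_digraph \<Rightarrow> 's \<Rightarrow> 'v \<Rightarrow> 'e" where
  "the_edge \<Gamma> s \<alpha> = (THE e. edge_at \<Gamma> s \<alpha> e)"

definition outgoing :: "('s, 'v, 'e) labeled_digraph \<Rightarrow> 's \<Rightarrow> 'v \<Rightarrow> bool" where
  "outgoing \<Gamma> s \<alpha> \<longleftrightarrow> \<alpha> = tail (digr \<Gamma>) (the_edge \<Gamma> s \<alpha>)"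

definition partner :: "('s, 'v, 'e) labeled_digraph \<Rightarrow> 's \<Rightarrow> 'v \<Rightarrow> 'v" where
  "partner \<Gamma> s \<alpha> =
     (if outgoing \<Gamma> s \<alpha> then head (digr \<Gamma>) (the_edge \<Gamma> s \<alpha>) else tail (digr \<Gamma>) (the_edge \<Gamma> s \<alpha>))"

definition dashed_at :: "('s, 'v, 'e) labeled_digraph \<Rightarrow> 's \<Rightarrow> 'v \<Rightarrow> bool" where
  "dashed_at \<Gamma> s \<alpha> \<longleftrightarrow> dashed \<Gamma> (the_edge \<Gamma> s \<alpha>)"

text \<open>
  The parameter is kept generic so that the same matrix can be specialized to \<open>u\<close>, to its image
  under a field automorphism, to the polynomial variable, and to \<open>0\<close>.
\<close>

definition edge_matrix ::
  "('s, 'v, 'e) labeled_digraph \<Rightarrow> 's \<Rightarrow> 'a::comm_ring_1 \<Rightarrow> 'v \<Rightarrow> 'v \<Rightarrow> 'a" where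
  "edge_matrix \<Gamma> s x i j =
     (if i = j then edge_diag x (dashed_at \<Gamma> s j) (outgoing \<Gamma> s j)
      else if i = partner \<Gamma> s j then edge_off x (dashed_at \<Gamma> s j) (outgoing \<Gamma> s j)
      else 0)"

lemma rev_edge_at: "edge_at (rev_digraph \<Gamma>) s \<alpha> e \<longleftrightarrow> edge_at \<Gamma> s \<alpha> e"
  by (auto simp: edge_at_def rev_digraph_def)

lemma rev_the_edge: "the_edge (rev_digraph \<Gamma>) s \<alpha> = the_edge \<Gamma> s \<alpha>"
  by (simp add: the_edge_def rev_edge_at)

lemma rev_vertices: "vertices (rev_digraph \<Gamma>) = vertices \<Gamma>"
  by (simp add: rev_digraph_def)

lemma rev_dashed_at: "dashed_at (rev_digraph \<Gamma>) s \<alpha> = dashed_at \<Gamma> s \<alpha>"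
  by (simp add: dashed_at_def rev_the_edge) (simp add: rev_digraph_def)

lemma lookup_vscale: "Poly_Mapping.lookup (vscale c x) i = c * Poly_Mapping.lookup x i"
  by (simp add: vscale_def Poly_Mapping.map.rep_eq when_def)

context
  fixes S :: "'s set" and \<Gamma> :: "('s, 'v, 'e) labeled_digraph"
  assumes labeled: "S_labeled_digraph S \<Gamma>"
begin

interpretation loopfree_digraph "digr \<Gamma>"
  using labeled unfolding S_labeled_digraph_def by blast

lemma edge_at_the_edge: "s \<in> S \<Longrightarrow> \<alpha> \<in> vertices \<Gamma> \<Longrightarrow> edge_at \<Gamma> s \<alpha> (the_edge \<Gamma> s \<alpha>)"
  unfolding the_edge_def using labeled unfolding S_labeled_digraph_def by (metis theI')

lemma the_edge_eqI: "s \<in> S \<Longrightarrow> \<alpha> \<in> vertices \<Gamma> \<Longrightarrow> edge_at \<Gamma> s \<alpha> e \<Longrightarrow> the_edge \<Gamma> s \<alpha> = e"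
  using edge_at_the_edge labeled unfolding S_labeled_digraph_def by metis

lemma partner_in_vertices: "s \<in> S \<Longrightarrow> \<alpha> \<in> vertices \<Gamma> \<Longrightarrow> partner \<Gamma> s \<alpha> \<in> vertices \<Gamma>"
  using edge_at_the_edge[of s \<alpha>] by (auto simp: partner_def edge_at_def)

lemma partner_neq: "s \<in> S \<Longrightarrow> \<alpha> \<in> vertices \<Gamma> \<Longrightarrow> partner \<Gamma> s \<alpha> \<noteq> \<alpha>"
  using edge_at_the_edge[of s \<alpha>] no_loops[of "the_edge \<Gamma> s \<alpha>"]
  by (auto simp: partner_def outgoing_def edge_at_def)

lemma the_edge_partner:
  assumes "s \<in> S" "\<alpha> \<in> vertices \<Gamma>"
  shows "the_edge \<Gamma> s (partner \<Gamma> s \<alpha>) = the_edge \<Gamma> s \<alpha>"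
  using edge_at_the_edge[OF assms] partner_in_vertices[OF assms] assms(1)
  by (intro the_edge_eqI) (auto simp: edge_at_def partner_def)

lemma outgoing_partner:
  assumes "s \<in> S" "\<alpha> \<in> vertices \<Gamma>"
  shows "outgoing \<Gamma> s (partner \<Gamma> s \<alpha>) \<longleftrightarrow> \<not> outgoing \<Gamma> s \<alpha>"
  using edge_at_the_edge[OF assms] no_loops[of "the_edge \<Gamma> s \<alpha>"]
  unfolding outgoing_def the_edge_partner[OF assms]
  by (auto simp: partner_def outgoing_def edge_at_def)

lemma dashed_at_partner:
  "s \<in> S \<Longrightarrow> \<alpha> \<in> vertices \<Gamma> \<Longrightarrow> dashed_at \<Gamma> s (partner \<Gamma> s \<alpha>) = dashed_at \<Gamma> s \<alpha>"
  by (simp add: dashed_at_def the_edge_partner)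

lemma partner_partner:
  assumes "s \<in> S" "\<alpha> \<in> vertices \<Gamma>"
  shows "partner \<Gamma> s (partner \<Gamma> s \<alpha>) = \<alpha>"
  using edge_at_the_edge[OF assms] outgoing_partner[OF assms] the_edge_partner[OF assms]
  by (auto simp: partner_def[of _ _ "partner \<Gamma> s \<alpha>"] edge_at_def)
    (auto simp: outgoing_def)

lemma outgoing_arc:
  assumes "s \<in> S" "\<alpha> \<in> vertices \<Gamma>" "outgoing \<Gamma> s \<alpha>"
  shows "(\<alpha>, partner \<Gamma> s \<alpha>) \<in> arcs_ends (digr \<Gamma>)"
  using edge_at_the_edge[OF assms(1,2)] assms(3)
  by (auto simp: arcs_ends_conv partner_def edge_at_def outgoing_def image_iff)

lemma arc_outgoing:
  assumes "(\<alpha>, \<beta>) \<in> arcs_ends (digr \<Gamma>)"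
  obtains s where "s \<in> S" "\<alpha> \<in> vertices \<Gamma>" "outgoing \<Gamma> s \<alpha>" "\<beta> = partner \<Gamma> s \<alpha>"
proof -
  obtain e where e: "e \<in> arcs (digr \<Gamma>)" "\<alpha> = tail (digr \<Gamma>) e" "\<beta> = head (digr \<Gamma>) e"
    using assms by (auto simp: arcs_ends_conv)
  have s: "label \<Gamma> e \<in> S" "\<alpha> \<in> vertices \<Gamma>"
    using e labeled unfolding S_labeled_digraph_def by auto
  then have "the_edge \<Gamma> (label \<Gamma> e) \<alpha> = e"
    using e by (intro the_edge_eqI) (auto simp: edge_at_def)
  then show thesis using that[of "label \<Gamma> e"] s e by (auto simp: outgoing_def partner_def)
qed

lemma rev_labeled: "S_labeled_digraph S (rev_digraph \<Gamma>)"
proof -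
  have "loopfree_digraph (digr (rev_digraph \<Gamma>))"
    by unfold_locales (use no_loops in \<open>auto simp: rev_digraph_def\<close>, force dest: no_loops)
  moreover have "label (rev_digraph \<Gamma>) ` arcs (digr (rev_digraph \<Gamma>)) \<subseteq> S"
    using labeled by (simp add: S_labeled_digraph_def rev_digraph_def)
  ultimately show ?thesis
    using labeled unfolding S_labeled_digraph_def rev_edge_at rev_vertices by blast
qed

lemma rev_outgoing:
  assumes "s \<in> S" "\<alpha> \<in> vertices \<Gamma>"
  shows "outgoing (rev_digraph \<Gamma>) s \<alpha> \<longleftrightarrow> \<not> outgoing \<Gamma> s \<alpha>"
  using edge_at_the_edge[OF assms] no_loops[of "the_edge \<Gamma> s \<alpha>"]
  by (auto simp: outgoing_def rev_the_edge) (auto simp: rev_digraph_def edge_at_def)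

lemma rev_partner:
  assumes "s \<in> S" "\<alpha> \<in> vertices \<Gamma>"
  shows "partner (rev_digraph \<Gamma>) s \<alpha> = partner \<Gamma> s \<alpha>"
  using rev_outgoing[OF assms] by (simp add: partner_def rev_the_edge) (simp add: rev_digraph_def)

lemma rev_edge_matrix:
  assumes "s \<in> S" "j \<in> vertices \<Gamma>"
  shows "edge_matrix (rev_digraph \<Gamma>) s x i j =
     (if i = j then edge_diag x (dashed_at \<Gamma> s j) (\<not> outgoing \<Gamma> s j)
      else if i = partner \<Gamma> s j then edge_off x (dashed_at \<Gamma> s j) (\<not> outgoing \<Gamma> s j)
      else 0)"
  using assms by (simp add: edge_matrix_def rev_outgoing rev_partner rev_dashed_at)

text \<open>
  The neighbour of a vertex sees the same edge with the opposite orientation, and so does the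
  vertex itself after reversal; transposition and reversal therefore have the same coefficients off the
  diagonal.
\<close>

lemma edge_matrix_transpose:
  assumes "s \<in> S" "i \<in> vertices \<Gamma>" "j \<in> vertices \<Gamma>" "i \<noteq> j"
  shows "edge_matrix \<Gamma> s x j i =
     (if i = partner \<Gamma> s j then edge_off x (dashed_at \<Gamma> s j) (\<not> outgoing \<Gamma> s j) else 0)"
proof -
  have "j = partner \<Gamma> s i \<longleftrightarrow> i = partner \<Gamma> s j"
    using assms partner_partner by metis
  then show ?thesis
    using assms outgoing_partner[of s j] dashed_at_partner[of s j] by (auto simp: edge_matrix_def)
qed

lemma lookup_tau_vertex:
  assumes "s \<in> S" "j \<in> vertices \<Gamma>"
  shows "Poly_Mapping.lookup (tau_vertex \<Gamma> s j) i = edge_matrix \<Gamma> s u i j"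
  using partner_neq[OF assms]
  unfolding tau_vertex_def the_edge_def[symmetric] Let_def
  by (auto simp: lookup_add lookup_vscale basis_vec_def lookup_single when_def edge_matrix_def
      edge_diag_def edge_off_def dashed_at_def partner_def outgoing_def)

end

section \<open>Representations by operators and by matrices\<close>

lemma M_space_iff: "x \<in> M_space \<Gamma> \<longleftrightarrow> (\<forall>i. i \<notin> vertices \<Gamma> \<longrightarrow> Poly_Mapping.lookup x i = 0)"
  by (auto simp: M_space_def in_keys_iff)

lemma M_space_closed:
  "0 \<in> M_space \<Gamma>"
  "x \<in> M_space \<Gamma> \<Longrightarrow> y \<in> M_space \<Gamma> \<Longrightarrow> x + y \<in> M_space \<Gamma>"
  "x \<in> M_space \<Gamma> \<Longrightarrow> vscale c x \<in> M_space \<Gamma>"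
  "\<alpha> \<in> vertices \<Gamma> \<Longrightarrow> basis_vec \<alpha> \<in> M_space \<Gamma>"
  by (auto simp: M_space_iff lookup_add lookup_vscale basis_vec_def lookup_single when_def)

text \<open>
  The passage between operators on the space spanned by the vertices and matrices. Restricting the
  domain makes an operator equal to any other one with the same matrix.
\<close>

definition matrix_operator ::
  "('s, 'v, 'e) labeled_digraph \<Rightarrow> ('v \<Rightarrow> 'v \<Rightarrow> ratfun) \<Rightarrow> ('v \<Rightarrow>\<^sub>0 ratfun) \<Rightarrow> ('v \<Rightarrow>\<^sub>0 ratfun)" where
  "matrix_operator \<Gamma> A = (\<lambda>x\<in>M_space \<Gamma>.
     \<Sum>i\<in>vertices \<Gamma>. Poly_Mapping.single i (\<Sum>j\<in>vertices \<Gamma>. A i j * Poly_Mapping.lookup x j))"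

definition operator_matrix :: "(('v \<Rightarrow>\<^sub>0 ratfun) \<Rightarrow> ('v \<Rightarrow>\<^sub>0 ratfun)) \<Rightarrow> 'v \<Rightarrow> 'v \<Rightarrow> ratfun" where
  "operator_matrix \<phi> i j = Poly_Mapping.lookup (\<phi> (basis_vec j)) i"

context
  fixes \<Gamma> :: "('s, 'v, 'e) labeled_digraph"
  assumes finite_V: "finite (vertices \<Gamma>)"
begin

lemma lookup_matrix_operator:
  assumes "x \<in> M_space \<Gamma>"
  shows "Poly_Mapping.lookup (matrix_operator \<Gamma> A x) i =
    (if i \<in> vertices \<Gamma> then \<Sum>j\<in>vertices \<Gamma>. A i j * Poly_Mapping.lookup x j else 0)"
  using assms finite_V by (simp add: matrix_operator_def lookup_sum lookup_single when_def)

lemma matrix_operator_in_M_space: "x \<in> M_space \<Gamma> \<Longrightarrow> matrix_operator \<Gamma> A x \<in> M_space \<Gamma>"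
  by (simp add: M_space_iff[of "matrix_operator \<Gamma> A x"] lookup_matrix_operator)

lemma operator_matrix_matrix_operator:
  "i \<in> vertices \<Gamma> \<Longrightarrow> j \<in> vertices \<Gamma> \<Longrightarrow> operator_matrix (matrix_operator \<Gamma> A) i j = A i j"
  using finite_V
  by (simp add: operator_matrix_def lookup_matrix_operator M_space_closed)
    (simp add: basis_vec_def lookup_single when_def if_distrib cong: if_cong)

lemma lookup_lin_operator:
  assumes \<phi>: "\<phi> \<in> lin_operators \<Gamma>" and x: "x \<in> M_space \<Gamma>"
  shows "Poly_Mapping.lookup (\<phi> x) i =
    (\<Sum>j\<in>vertices \<Gamma>. operator_matrix \<phi> i j * Poly_Mapping.lookup x j)"
proof -
  have add: "\<phi> (y + z) = \<phi> y + \<phi> z" if "y \<in> M_space \<Gamma>" "z \<in> M_space \<Gamma>" for y z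
    using \<phi> that by (simp add: lin_operators_def)
  have scl: "\<phi> (vscale c y) = vscale c (\<phi> y)" if "y \<in> M_space \<Gamma>" for c y
    using \<phi> that by (simp add: lin_operators_def)
  have zero: "\<phi> 0 = 0"
    using add[of 0 0] by (simp add: M_space_closed)
  let ?y = "\<lambda>F. \<Sum>j\<in>F. vscale (Poly_Mapping.lookup x j) (basis_vec j)"
  have aux: "?y F \<in> M_space \<Gamma> \<and>
      Poly_Mapping.lookup (\<phi> (?y F)) i = (\<Sum>j\<in>F. operator_matrix \<phi> i j * Poly_Mapping.lookup x j)"
    if "finite F" "F \<subseteq> vertices \<Gamma>" for F
    using that
    by (induction F rule: finite_induct)
      (simp_all add: zero add scl M_space_closed lookup_add lookup_vscale operator_matrix_def)
  have y: "?y (vertices \<Gamma>) = x"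
  proof (rule poly_mapping_eqI)
    fix i
    have "Poly_Mapping.lookup (?y (vertices \<Gamma>)) i =
        (\<Sum>j\<in>vertices \<Gamma>. if j = i then Poly_Mapping.lookup x j else 0)"
      unfolding lookup_sum lookup_vscale
      by (rule sum.cong) (simp_all add: basis_vec_def lookup_single when_def)
    then show "Poly_Mapping.lookup (?y (vertices \<Gamma>)) i = Poly_Mapping.lookup x i"
      using x finite_V by (simp add: M_space_iff)
  qed
  show ?thesis using aux[OF finite_V order_refl] unfolding y by blast
qed

lemma lookup_tau:
  assumes "S_labeled_digraph S \<Gamma>" "s \<in> S" "x \<in> M_space \<Gamma>"
  shows "Poly_Mapping.lookup (tau \<Gamma> s x) i =
    (\<Sum>j\<in>vertices \<Gamma>. edge_matrix \<Gamma> s u i j * Poly_Mapping.lookup x j)"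
proof -
  have k: "Poly_Mapping.keys x \<subseteq> vertices \<Gamma>" using assms by (simp add: M_space_def)
  have "Poly_Mapping.lookup (tau \<Gamma> s x) i =
      (\<Sum>j\<in>Poly_Mapping.keys x. Poly_Mapping.lookup x j * Poly_Mapping.lookup (tau_vertex \<Gamma> s j) i)"
    by (simp add: tau_def lookup_sum lookup_vscale)
  also have "\<dots> =
      (\<Sum>j\<in>vertices \<Gamma>. Poly_Mapping.lookup x j * Poly_Mapping.lookup (tau_vertex \<Gamma> s j) i)"
    using k finite_V by (intro sum.mono_neutral_left) (auto simp: in_keys_iff)
  also have "\<dots> = (\<Sum>j\<in>vertices \<Gamma>. edge_matrix \<Gamma> s u i j * Poly_Mapping.lookup x j)"
    using assms by (intro sum.cong) (simp_all add: lookup_tau_vertex)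
  finally show ?thesis .
qed

lemma edge_matrix_outside:
  assumes "S_labeled_digraph S \<Gamma>" "s \<in> S" "i \<notin> vertices \<Gamma>" "j \<in> vertices \<Gamma>"
  shows "edge_matrix \<Gamma> s x i j = 0"
  using assms partner_in_vertices[OF assms(1,2,4)] by (auto simp: edge_matrix_def)

lemma extends_tau_matrix_operator:
  assumes lab: "S_labeled_digraph S \<Gamma>"
    and R: "matrix_representation scale (vertices \<Gamma>) R"
    and gen: "\<And>s i j. s \<in> S \<Longrightarrow> i \<in> vertices \<Gamma> \<Longrightarrow> j \<in> vertices \<Gamma> \<Longrightarrow> R (T s) i j = edge_matrix \<Gamma> s u i j"
  shows "extends_tau scale S T \<Gamma> (\<lambda>a. matrix_operator \<Gamma> (R a))"
proof -
  note R = matrix_representationD[OF R]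
  note lk = lookup_matrix_operator lookup_add lookup_vscale
  have undef: "matrix_operator \<Gamma> A x = undefined" if "x \<notin> M_space \<Gamma>" for A x
    using that by (simp add: matrix_operator_def)
  have eqI: "f = matrix_operator \<Gamma> A" if "\<And>x. x \<notin> M_space \<Gamma> \<Longrightarrow> f x = undefined"
    "\<And>x i. x \<in> M_space \<Gamma> \<Longrightarrow> Poly_Mapping.lookup (f x) i = Poly_Mapping.lookup (matrix_operator \<Gamma> A x) i"
  for f A
  proof (rule ext)
    fix x show "f x = matrix_operator \<Gamma> A x"
      using that undef by (cases "x \<in> M_space \<Gamma>") (auto intro: poly_mapping_eqI)
  qed
  have "matrix_operator \<Gamma> A \<in> lin_operators \<Gamma>" for A
    by (auto simp: lin_operators_def matrix_operator_in_M_space undef intro!: poly_mapping_eqI)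
      (simp_all add: lk M_space_closed distrib_left sum.distrib sum_distrib_left mult.left_commute)
  moreover have "matrix_operator \<Gamma> (R (a + b)) =
      (\<lambda>x\<in>M_space \<Gamma>. matrix_operator \<Gamma> (R a) x + matrix_operator \<Gamma> (R b) x)" for a b
    by (intro eqI[symmetric]) (simp_all add: lk R(1) distrib_right sum.distrib)
  moreover have "matrix_operator \<Gamma> (R (scale c a)) =
      (\<lambda>x\<in>M_space \<Gamma>. vscale c (matrix_operator \<Gamma> (R a) x))" for c a
    by (intro eqI[symmetric]) (simp_all add: lk R(2) sum_distrib_left mult.assoc)
  moreover have "matrix_operator \<Gamma> (R 1) = (\<lambda>x\<in>M_space \<Gamma>. x)"
  proof (intro eqI[symmetric])
    fix x i assume x: "x \<in> M_space \<Gamma>"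
    have "(\<Sum>j\<in>vertices \<Gamma>. mat_one i j * Poly_Mapping.lookup x j) = Poly_Mapping.lookup x i"
      if "i \<in> vertices \<Gamma>"
      using mat_mult_one_left[OF finite_V that, of "\<lambda>j k. Poly_Mapping.lookup x j"]
      by (simp only: mat_mult_def)
    moreover have "Poly_Mapping.lookup x i = 0" if "i \<notin> vertices \<Gamma>"
      using x that by (simp add: M_space_iff)
    ultimately show "Poly_Mapping.lookup ((\<lambda>x\<in>M_space \<Gamma>. x) x) i =
        Poly_Mapping.lookup (matrix_operator \<Gamma> (R 1) x) i"
      using x by (simp add: lk R(3))
  qed simp
  moreover have "matrix_operator \<Gamma> (R (a * b)) =
      compose (M_space \<Gamma>) (matrix_operator \<Gamma> (R a)) (matrix_operator \<Gamma> (R b))" for a b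
  proof (intro eqI[symmetric])
    fix x i assume x: "x \<in> M_space \<Gamma>"
    have "(\<Sum>j\<in>vertices \<Gamma>. mat_mult (vertices \<Gamma>) (R a) (R b) i j * Poly_Mapping.lookup x j) =
        (\<Sum>j\<in>vertices \<Gamma>. R a i j * (\<Sum>k\<in>vertices \<Gamma>. R b j k * Poly_Mapping.lookup x k))"
      using mat_mult_assoc[of "vertices \<Gamma>" "R a" "R b" "\<lambda>j k. Poly_Mapping.lookup x j" i i]
      by (simp only: mat_mult_def)
    moreover have "(\<Sum>j\<in>vertices \<Gamma>. R (a * b) i j * Poly_Mapping.lookup x j) =
        (\<Sum>j\<in>vertices \<Gamma>. mat_mult (vertices \<Gamma>) (R a) (R b) i j * Poly_Mapping.lookup x j)"
      if "i \<in> vertices \<Gamma>"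
      using that by (intro sum.cong) (simp_all add: R(4))
    ultimately show "Poly_Mapping.lookup (compose (M_space \<Gamma>) (matrix_operator \<Gamma> (R a)) (matrix_operator \<Gamma> (R b)) x) i
        = Poly_Mapping.lookup (matrix_operator \<Gamma> (R (a * b)) x) i"
      by (cases "i \<in> vertices \<Gamma>")
        (simp_all only: compose_eq[OF x] lookup_matrix_operator matrix_operator_in_M_space x
          if_True if_False simp_thms cong: sum.cong)
  qed (simp add: compose_def)
  moreover have "matrix_operator \<Gamma> (R (T s)) = restrict (tau \<Gamma> s) (M_space \<Gamma>)" if "s \<in> S" for s
  proof (intro eqI[symmetric])
    fix x i assume x: "x \<in> M_space \<Gamma>"
    have "(\<Sum>j\<in>vertices \<Gamma>. edge_matrix \<Gamma> s u i j * Poly_Mapping.lookup x j) =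
        Poly_Mapping.lookup (matrix_operator \<Gamma> (R (T s)) x) i"
      unfolding lookup_matrix_operator[OF x]
      using gen[OF that] edge_matrix_outside[OF lab that, of i] by (auto intro!: sum.cong sum.neutral)
    then show "Poly_Mapping.lookup (restrict (tau \<Gamma> s) (M_space \<Gamma>) x) i =
        Poly_Mapping.lookup (matrix_operator \<Gamma> (R (T s)) x) i"
      using x lookup_tau[OF lab that x] by simp
  qed simp
  ultimately show ?thesis
    unfolding extends_tau_def algebra_hom_to_operators_def by blast
qed

lemma matrix_representation_of_extends_tau:
  assumes lab: "S_labeled_digraph S \<Gamma>" and \<rho>: "extends_tau scale S T \<Gamma> \<rho>"
  defines "R \<equiv> \<lambda>a. operator_matrix (\<rho> a)"
  shows "matrix_representation scale (vertices \<Gamma>) R"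
    and "\<And>s i j. s \<in> S \<Longrightarrow> j \<in> vertices \<Gamma> \<Longrightarrow> R (T s) i j = edge_matrix \<Gamma> s u i j"
proof -
  have hom: "algebra_hom_to_operators scale \<Gamma> \<rho>"
    and gen: "\<And>s. s \<in> S \<Longrightarrow> \<rho> (T s) = restrict (tau \<Gamma> s) (M_space \<Gamma>)"
    using \<rho> unfolding extends_tau_def by blast+
  have lin: "\<rho> a \<in> lin_operators \<Gamma>"
    and eqs: "\<rho> (a + b) = (\<lambda>x\<in>M_space \<Gamma>. \<rho> a x + \<rho> b x)"
      "\<rho> (scale c a) = (\<lambda>x\<in>M_space \<Gamma>. vscale c (\<rho> a x))"
      "\<rho> 1 = (\<lambda>x\<in>M_space \<Gamma>. x)"
      "\<rho> (a * b) = compose (M_space \<Gamma>) (\<rho> a) (\<rho> b)" for a b c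
    using hom unfolding algebra_hom_to_operators_def by blast+
  have closed: "\<rho> a x \<in> M_space \<Gamma>" if "x \<in> M_space \<Gamma>" for a x
    using lin[of a] that unfolding lin_operators_def by blast
  have "R (a * b) i j = mat_mult (vertices \<Gamma>) (R a) (R b) i j" if "j \<in> vertices \<Gamma>" for a b i j
    using that lookup_lin_operator[OF lin closed[of "basis_vec j"], of a b i]
    by (simp add: R_def operator_matrix_def[of "\<rho> (a * b)"] eqs(4) compose_def M_space_closed mat_mult_def)
      (simp add: operator_matrix_def M_space_closed)
  then show "matrix_representation scale (vertices \<Gamma>) R"
    unfolding matrix_representation_def
    by (simp add: R_def operator_matrix_def eqs(1-3) M_space_closed lookup_add lookup_vscale)
      (simp add: basis_vec_def lookup_single mat_one_def when_def)
  show "R (T s) i j = edge_matrix \<Gamma> s u i j" if "s \<in> S" "j \<in> vertices \<Gamma>" for s i j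
    using that lookup_tau[OF lab that(1), of "basis_vec j" i] finite_V
    by (simp add: R_def operator_matrix_def gen M_space_closed)
      (simp add: basis_vec_def lookup_single when_def if_distrib cong: if_cong)
qed

end

context coxeter_hecke
begin

text \<open>
  The basis elements are products of generators, on which both homomorphisms are prescribed.
\<close>

lemma extends_tau_unique:
  assumes "extends_tau scale S T \<Gamma> \<rho>" "extends_tau scale S T \<Gamma> \<rho>'"
  shows "\<rho> = \<rho>'"
proof
  fix a
  have hom: "algebra_hom_to_operators scale \<Gamma> \<rho>" "algebra_hom_to_operators scale \<Gamma> \<rho>'"
    and gen: "\<And>s. s \<in> S \<Longrightarrow> \<rho> (T s) = \<rho>' (T s)"
    using assms unfolding extends_tau_def by auto
  have basis: "\<rho> (T w) = \<rho>' (T w)" if "w \<in> carrier W" for w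
    using that
  proof (induction rule: carrier_induct)
    case one
    then show ?case using hom by (simp add: T_one algebra_hom_to_operators_def)
  next
    case (step s w)
    then have "T (s \<otimes>\<^bsub>W\<^esub> w) = T s * T w" using T_mult_longer by simp
    then show ?case using step hom gen by (simp add: algebra_hom_to_operators_def)
  qed
  show "\<rho> a = \<rho>' a"
  proof (induction a rule: T_span_induct)
    case zero
    have "\<rho> (scale 0 1) = \<rho>' (scale 0 1)"
      using hom unfolding algebra_hom_to_operators_def by metis
    then show ?case by simp
  next
    case (step c w a)
    then show ?case using hom basis by (simp add: algebra_hom_to_operators_def)
  qed
qed

text \<open>
  By uniqueness of the homomorphism, the character may be read off from any matrix representation
  with the prescribed values on the generators.
\<close>

lemma chi_eq_matrix_trace:
  assumes fin: "finite (vertices \<Gamma>)" and "S_labeled_digraph S \<Gamma>"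
    and "matrix_representation scale (vertices \<Gamma>) R"
    and "\<And>s i j. s \<in> S \<Longrightarrow> i \<in> vertices \<Gamma> \<Longrightarrow> j \<in> vertices \<Gamma> \<Longrightarrow> R (T s) i j = edge_matrix \<Gamma> s u i j"
  shows "chi scale S T \<Gamma> a = (\<Sum>i\<in>vertices \<Gamma>. R a i i)"
proof -
  have "(THE \<rho>. extends_tau scale S T \<Gamma> \<rho>) = (\<lambda>a. matrix_operator \<Gamma> (R a))"
    using extends_tau_matrix_operator[OF assms] extends_tau_unique by blast
  then show ?thesis
    unfolding chi_def op_trace_def operator_matrix_def[symmetric]
    using operator_matrix_matrix_operator[OF fin] by simp
qed

end

section \<open>Specialization and reversal of the edge matrices\<close>

text \<open>
  Unital ring homomorphisms between types. Three of them occur below: the automorphism \<open>\<sigma>\<close>, the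
  inclusion of \<open>\<rat>[u]\<close> into \<open>\<rat>(u)\<close>, and the evaluation of polynomials at a point.
\<close>

locale comm_ring_map =
  fixes h :: "'a::comm_ring_1 \<Rightarrow> 'b::comm_ring_1"
  assumes map_add: "h (x + y) = h x + h y"
    and map_mult: "h (x * y) = h x * h y"
    and map_one: "h 1 = 1"
begin

lemma map_zero: "h 0 = 0"
  using map_add[of 0 0] by simp

lemma map_diff: "h (x - y) = h x - h y"
  using map_add[of "x - y" y] by (simp add: algebra_simps)

lemma map_power: "h (x ^ k) = h x ^ k"
  by (induction k) (simp_all add: map_one map_mult)

lemma map_sum: "h (\<Sum>k\<in>A. f k) = (\<Sum>k\<in>A. h (f k))"
  by (induction A rule: infinite_finite_induct) (simp_all add: map_zero map_add)

lemma map_mat_one: "h (mat_one i j) = mat_one i j"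
  by (simp add: mat_one_def map_one map_zero)

lemma map_edge_matrix: "h (edge_matrix \<Gamma> s x i j) = edge_matrix \<Gamma> s (h x) i j"
  by (simp add: edge_matrix_def edge_diag_def edge_off_def map_zero map_one map_add map_diff map_power)

end

lemma edge_diag_reverse: "edge_diag x d (\<not> out) = x\<^sup>2 - 1 - edge_diag x d out"
  by (simp add: edge_diag_def)

lemma edge_diag_sigma:
  fixes x :: "'a::field"
  assumes "x \<noteq> 0"
  shows "edge_diag x d (\<not> out) = x\<^sup>2 * edge_diag (- 1 / x) d out + (x\<^sup>2 - 1)"
  using assms by (simp add: edge_diag_def field_simps power2_eq_square)

lemma edge_off_sigma:
  fixes x :: "'a::field"
  assumes "x \<noteq> 0"
  shows "edge_off x d (\<not> out) = x\<^sup>2 * edge_off (- 1 / x) d out"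
  using assms by (simp add: edge_off_def field_simps power2_eq_square)

text \<open>
  On the plane spanned by the ends of an edge, the operator of the reversed edge is the image of
  the inverse operator under \<open>u \<mapsto> - 1 / u\<close>; since the inverse of \<open>\<tau>\<close> is
  \<open>u\<^sup>-\<^sup>2 (\<tau> - (u\<^sup>2 - 1))\<close>, this is the identity below.
\<close>

lemma rev_edge_matrix_sigma:
  assumes "S_labeled_digraph S \<Gamma>" "s \<in> S" "j \<in> vertices \<Gamma>" "x \<noteq> (0::'a::field)"
  shows "edge_matrix (rev_digraph \<Gamma>) s x i j =
    x\<^sup>2 * edge_matrix \<Gamma> s (- 1 / x) i j + (x\<^sup>2 - 1) * mat_one i j"
  using assms
  by (simp add: rev_edge_matrix edge_diag_sigma edge_off_sigma) (simp add: edge_matrix_def mat_one_def)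

text \<open>
  A second description of the reversed operator, without a field automorphism: transpose
  \<open>- u\<^sup>2 \<tau>\<^sup>-\<^sup>1 = u\<^sup>2 - 1 - \<tau>\<close> and conjugate by a diagonal matrix of signs. The signs are
  needed to correct the entries off the diagonal, so they have to differ at the ends of every edge.
\<close>

lemma rev_edge_matrix_transpose:
  assumes lab: "S_labeled_digraph S \<Gamma>" and s: "s \<in> S"
    and ij: "i \<in> vertices \<Gamma>" "j \<in> vertices \<Gamma>"
    and sign: "\<And>\<alpha>. \<alpha> \<in> vertices \<Gamma> \<Longrightarrow> D \<alpha> * D \<alpha> = (1::'a::comm_ring_1)"
      "\<And>\<alpha>. \<alpha> \<in> vertices \<Gamma> \<Longrightarrow> D (partner \<Gamma> s \<alpha>) = - D \<alpha>"
  shows "edge_matrix (rev_digraph \<Gamma>) s x i j =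
    D i * D j * ((x\<^sup>2 - 1) * mat_one i j - edge_matrix \<Gamma> s x j i)"
proof (cases "i = j")
  case True
  then show ?thesis
    using sign(1)[OF ij(2)] unfolding rev_edge_matrix[OF lab s ij(2)]
    by (simp add: edge_diag_reverse mat_one_def edge_matrix_def)
next
  case False
  then show ?thesis
    using sign[OF ij(2)] unfolding rev_edge_matrix[OF lab s ij(2)]
      edge_matrix_transpose[OF lab s ij False]
    by (simp add: mat_one_def)
qed


section \<open>A sign function on an acyclic digraph\<close>

text \<open>
  This is Newman's lemma with parities. The function is the parity of the length of the paths from a
  vertex \<open>a\<close> to a vertex without successors, and the point is that all of them agree. For two such
  paths that start with steps to \<open>b\<close> and \<open>c\<close>, continue the two joining paths from their common end
  \<open>d\<close>; the induction hypothesis at \<open>b\<close> and at \<open>c\<close> compares each of the given paths with the one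
  through \<open>d\<close>.
\<close>

lemma parity_grading:
  assumes wf: "wf (E\<inverse>)"
    and join: "\<And>a b c. (a, b) \<in> E \<Longrightarrow> (a, c) \<in> E \<Longrightarrow>
       \<exists>d m k. (b, d) \<in> E ^^ m \<and> (c, d) \<in> E ^^ k \<and> (even m \<longleftrightarrow> even k)"
  shows "\<exists>f. \<forall>(a, b)\<in>E. f a \<longleftrightarrow> \<not> f b"
proof -
  define reach where "reach a m \<longleftrightarrow> (\<exists>x. (a, x) \<in> E ^^ m \<and> x \<notin> Domain E)" for a m
  have ex: "\<exists>m. reach a m" for a
    using wf
  proof (induction a rule: wf_induct_rule)
    case (less a)
    show ?case
    proof (cases "a \<in> Domain E")
      case True
      then obtain b m where b: "(a, b) \<in> E" and "reach b m" using less by blast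
      then have "reach a (Suc m)" unfolding reach_def using relpow_Suc_I2[OF b] by blast
      then show ?thesis ..
    next
      case False
      then have "reach a 0" by (auto simp: reach_def)
      then show ?thesis ..
    qed
  qed
  have uniq: "reach a m \<Longrightarrow> reach a k \<Longrightarrow> even m \<longleftrightarrow> even k" for a m k
    using wf
  proof (induction a arbitrary: m k rule: wf_induct_rule)
    case (less a)
    obtain x y where x: "(a, x) \<in> E ^^ m" "x \<notin> Domain E" and y: "(a, y) \<in> E ^^ k" "y \<notin> Domain E"
      using less.prems unfolding reach_def by blast
    show ?case
    proof (cases m)
      case 0
      then have "a \<notin> Domain E" using x by simp
      then have "k = 0" using y by (metis DomainI not0_implies_Suc relpow_Suc_D2)
      then show ?thesis using 0 by simp
    next
      case (Suc m')
      then obtain b where b: "(a, b) \<in> E" "(b, x) \<in> E ^^ m'"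
        using x by (metis relpow_Suc_D2)
      then have "k \<noteq> 0" using y by (cases k) auto
      then obtain k' where k': "k = Suc k'" by (cases k) auto
      then obtain c where c: "(a, c) \<in> E" "(c, y) \<in> E ^^ k'"
        using y by (metis relpow_Suc_D2)
      obtain d p q where d: "(b, d) \<in> E ^^ p" "(c, d) \<in> E ^^ q" "even p \<longleftrightarrow> even q"
        using join[OF b(1) c(1)] by blast
      obtain r where "reach d r" using ex by blast
      then have "reach b (p + r)" "reach c (q + r)"
        using d unfolding reach_def relpow_add by blast+
      moreover have "reach b m'" "reach c k'"
        using b c x y unfolding reach_def by blast+
      ultimately have "even m' \<longleftrightarrow> even (p + r)" "even k' \<longleftrightarrow> even (q + r)"
        using less.IH b(1) c(1) by blast+
      then show ?thesis using d(3) Suc k' by simp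
    qed
  qed
  \<comment> \<open>By \<open>uniq\<close>, the existence of one even path means that all paths are even.\<close>
  define f where "f a \<longleftrightarrow> (\<exists>m. reach a m \<and> even m)" for a
  have "f a \<longleftrightarrow> \<not> f b" if ab: "(a, b) \<in> E" for a b
  proof -
    obtain m where m: "reach b m" using ex by blast
    then have "reach a (Suc m)" unfolding reach_def using relpow_Suc_I2[OF ab] by blast
    then have "f a \<longleftrightarrow> even (Suc m)" unfolding f_def using uniq by blast
    moreover have "f b \<longleftrightarrow> even m" unfolding f_def using uniq m by blast
    ultimately show ?thesis by simp
  qed
  then show ?thesis by blast
qed

lemma acyclic_arcs_ends:
  assumes "wf_digraph (digr \<Gamma>)" "acyclic_digraph \<Gamma>"
  shows "acyclic (arcs_ends (digr \<Gamma>))"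
proof (rule acyclicI, intro allI notI)
  interpret wf_digraph "digr \<Gamma>" by fact
  fix x assume "(x, x) \<in> (arcs_ends (digr \<Gamma>))\<^sup>+"
  then obtain p where "awalk x p x" "p \<noteq> []" using reachable1_awalk by blast
  then have "\<exists>p. cycle p" by (intro closed_w_imp_cycle) (auto simp: closed_w_def)
  then show False using assms(2) by (simp add: acyclic_digraph_def)
qed

text \<open>
  The rightmost letter acts first on column vectors.
\<close>

primrec word_matrix :: "'v set \<Rightarrow> ('s \<Rightarrow> 'v \<Rightarrow> 'v \<Rightarrow> 'a::comm_ring_1) \<Rightarrow> 's list \<Rightarrow> 'v \<Rightarrow> 'v \<Rightarrow> 'a" where
  "word_matrix V M [] = mat_one"
| "word_matrix V M (s # ss) = mat_mult V (M s) (word_matrix V M ss)"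

lemma (in comm_ring_map) map_word_matrix:
  "h (word_matrix V M ss i j) = word_matrix V (\<lambda>s i j. h (M s i j)) ss i j"
  by (induction ss arbitrary: i) (simp_all add: map_mat_one mat_mult_def map_sum map_mult)

lemma word_matrix_snoc:
  assumes "finite V" "i \<in> V" "j \<in> V"
  shows "word_matrix V M (ss @ [s]) i j = mat_mult V (word_matrix V M ss) (M s) i j"
  using assms(2)
proof (induction ss arbitrary: i)
  case Nil
  have "mat_mult V (M s) mat_one i j = M s i j"
    using assms by (simp add: mat_mult_def mat_one_def if_distrib cong: if_cong)
  then show ?case using Nil assms by (simp add: mat_mult_one_left)
next
  case (Cons r ss)
  have "word_matrix V M ((r # ss) @ [s]) i j =
      mat_mult V (M r) (mat_mult V (word_matrix V M ss) (M s)) i j"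
    unfolding append_Cons word_matrix.simps by (rule mat_mult_cong) (simp_all add: Cons.IH)
  then show ?case by (simp add: mat_mult_assoc)
qed

lemma word_matrix_cong:
  assumes "\<And>s i j. s \<in> set ss \<Longrightarrow> i \<in> V \<Longrightarrow> j \<in> V \<Longrightarrow> M s i j = N s i j" "i \<in> V" "j \<in> V"
  shows "word_matrix V M ss i j = word_matrix V N ss i j"
  using assms
proof (induction ss arbitrary: i)
  case (Cons s ss)
  show ?case
    unfolding word_matrix.simps by (rule mat_mult_cong) (use Cons in auto)
qed simp

lemma word_matrix_representation:
  assumes R: "matrix_representation scale V R" and "i \<in> V" "j \<in> V"
  shows "R (prod_list (map T ss)) i j = word_matrix V (\<lambda>s. R (T s)) ss i j"
  using assms(2)
proof (induction ss arbitrary: i)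
  case Nil
  then show ?case using matrix_representationD(3)[OF R] assms by simp
next
  case (Cons s ss)
  have "R (prod_list (map T (s # ss))) i j = mat_mult V (R (T s)) (R (prod_list (map T ss))) i j"
    using matrix_representationD(4)[OF R Cons.prems assms(3)] by simp
  also have "\<dots> = mat_mult V (R (T s)) (word_matrix V (\<lambda>s. R (T s)) ss) i j"
    by (rule mat_mult_cong) (simp_all add: Cons.IH)
  finally show ?case by simp
qed

text \<open>
  The edge operators have entries in \<open>\<rat>[u]\<close>. At \<open>u = 0\<close> they forget the type of an edge: the
  tail is sent to the head, and the head to its negative.
\<close>

lemma edge_matrix_zero:
  assumes "S_labeled_digraph S \<Gamma>" "s \<in> S" "j \<in> vertices \<Gamma>"
  shows "edge_matrix \<Gamma> s (0::rat) i j =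
    (if outgoing \<Gamma> s j then (if i = partner \<Gamma> s j then 1 else 0) else (if i = j then - 1 else 0))"
  using partner_neq[OF assms] by (auto simp: edge_matrix_def edge_diag_def edge_off_def)

text \<open>
  A letter either moves the current vertex forward along an edge or changes the sign, so a word at
  \<open>u = 0\<close> follows a directed path, and the sign counts the letters not used for a step.
\<close>

lemma word_matrix_zero:
  assumes lab: "S_labeled_digraph S \<Gamma>" and fin: "finite (vertices \<Gamma>)"
    and "set ss \<subseteq> S" "j \<in> vertices \<Gamma>"
  shows "\<exists>\<omega> m. \<omega> \<in> vertices \<Gamma> \<and> m \<le> length ss \<and> (j, \<omega>) \<in> arcs_ends (digr \<Gamma>) ^^ m \<and>
    (\<forall>i. word_matrix (vertices \<Gamma>) (\<lambda>s. edge_matrix \<Gamma> s (0::rat)) ss i j =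
       (if i = \<omega> then (- 1) ^ (length ss - m) else 0))"
  using assms(3)
proof (induction ss)
  case Nil
  then show ?case using assms(4) by (intro exI[of _ j] exI[of _ 0]) (simp add: mat_one_def)
next
  case (Cons s ss)
  let ?M = "\<lambda>s. edge_matrix \<Gamma> s (0::rat)"
  obtain \<omega> m where \<omega>: "\<omega> \<in> vertices \<Gamma>" "m \<le> length ss" "(j, \<omega>) \<in> arcs_ends (digr \<Gamma>) ^^ m"
    and W: "\<And>i. word_matrix (vertices \<Gamma>) ?M ss i j = (if i = \<omega> then (- 1) ^ (length ss - m) else 0)"
    using Cons by auto
  have s: "s \<in> S" using Cons.prems by simp
  have col: "word_matrix (vertices \<Gamma>) ?M (s # ss) i j = ?M s i \<omega> * (- 1) ^ (length ss - m)" for i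
  proof -
    have "word_matrix (vertices \<Gamma>) ?M (s # ss) i j =
        (\<Sum>k\<in>vertices \<Gamma>. if k = \<omega> then ?M s i \<omega> * (- 1) ^ (length ss - m) else 0)"
      unfolding word_matrix.simps mat_mult_def W by (rule sum.cong) auto
    then show ?thesis using fin \<omega>(1) by simp
  qed
  show ?case
  proof (cases "outgoing \<Gamma> s \<omega>")
    case True
    have "(j, partner \<Gamma> s \<omega>) \<in> arcs_ends (digr \<Gamma>) ^^ Suc m"
      using relpow_Suc_I[OF \<omega>(3) outgoing_arc[OF lab s \<omega>(1) True]] .
    then show ?thesis
      using \<omega>(2) True partner_in_vertices[OF lab s \<omega>(1)]
      by (intro exI[of _ "partner \<Gamma> s \<omega>"] exI[of _ "Suc m"])
        (simp add: col edge_matrix_zero[OF lab s \<omega>(1)] del: word_matrix.simps relpow.simps)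
  next
    case False
    then show ?thesis
      using \<omega>
      by (intro exI[of _ \<omega>] exI[of _ m])
        (simp add: col edge_matrix_zero[OF lab s \<omega>(1)] Suc_diff_le del: word_matrix.simps)
  qed
qed

text \<open>
  At \<open>u = 0\<close> the letter that acts first moves a vertex to the head of its outgoing edge without any
  sign.
\<close>

lemma word_matrix_zero_snoc:
  assumes lab: "S_labeled_digraph S \<Gamma>" and fin: "finite (vertices \<Gamma>)"
    and s: "s \<in> S" and ij: "i \<in> vertices \<Gamma>" "j \<in> vertices \<Gamma>" and out: "outgoing \<Gamma> s j"
  shows "word_matrix (vertices \<Gamma>) (\<lambda>s. edge_matrix \<Gamma> s (0::rat)) (ss @ [s]) i j =
    word_matrix (vertices \<Gamma>) (\<lambda>s. edge_matrix \<Gamma> s 0) ss i (partner \<Gamma> s j)"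
proof -
  have "word_matrix (vertices \<Gamma>) (\<lambda>s. edge_matrix \<Gamma> s (0::rat)) (ss @ [s]) i j =
      (\<Sum>k\<in>vertices \<Gamma>. if k = partner \<Gamma> s j
         then word_matrix (vertices \<Gamma>) (\<lambda>s. edge_matrix \<Gamma> s 0) ss i k else 0)"
    unfolding word_matrix_snoc[OF fin ij] mat_mult_def
    using out by (intro sum.cong) (simp_all add: edge_matrix_zero[OF lab s ij(2)])
  then show ?thesis using fin partner_in_vertices[OF lab s ij(2)] by simp
qed

lemma u_to_fract: "u = to_fract [:0, 1:]"
  by (simp add: u_def to_fract_def)

text \<open>
  An identity between words in the edge operators is an identity between polynomials in \<open>u\<close>, so
  it may be specialized.
\<close>

lemma word_matrix_specialize:
  fixes c :: rat
  assumes "word_matrix V (\<lambda>s. edge_matrix \<Gamma> s u) ss i j = word_matrix V (\<lambda>s. edge_matrix \<Gamma> s u) ts i j"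
  shows "word_matrix V (\<lambda>s. edge_matrix \<Gamma> s c) ss i j = word_matrix V (\<lambda>s. edge_matrix \<Gamma> s c) ts i j"
proof -
  interpret F: comm_ring_map "to_fract :: rat poly \<Rightarrow> ratfun" by unfold_locales simp_all
  interpret P: comm_ring_map "\<lambda>p. poly p c" by unfold_locales simp_all
  let ?X = "\<lambda>s. edge_matrix \<Gamma> s [:0, 1 :: rat:]"
  have "to_fract (word_matrix V ?X ss i j) = to_fract (word_matrix V ?X ts i j)"
    using assms unfolding F.map_word_matrix F.map_edge_matrix u_to_fract .
  then have "poly (word_matrix V ?X ss i j) c = poly (word_matrix V ?X ts i j) c" by simp
  then show ?thesis by (simp add: P.map_word_matrix P.map_edge_matrix)
qed

context coxeter_hecke
begin

text \<open>
  Let the two edges be labeled \<open>s \<noteq> t\<close>, and compare both sides of a braid relation at \<open>u = 0\<close>, applied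
  to the common tail. One side starts with the step to \<open>\<beta>\<close>, the other one with the step to \<open>\<gamma>\<close>, and both
  continue with \<open>k\<close> letters. The results are vertices up to sign, so the vertices coincide, and so do
  the signs, which determine the parities of the numbers of steps.
\<close>

lemma local_confluence:
  fixes \<Gamma> :: "('w, 'v, 'e) labeled_digraph"
  assumes lab: "S_labeled_digraph S \<Gamma>" and finV: "finite (vertices \<Gamma>)"
    and R: "matrix_representation scale (vertices \<Gamma>) R"
    and gen: "\<And>s i j. s \<in> S \<Longrightarrow> i \<in> vertices \<Gamma> \<Longrightarrow> j \<in> vertices \<Gamma> \<Longrightarrow> R (T s) i j = edge_matrix \<Gamma> s u i j"
    and fin: "\<forall>s\<in>S. \<forall>t\<in>S. n s t < \<infinity>"
    and arcs: "(\<alpha>, \<beta>) \<in> arcs_ends (digr \<Gamma>)" "(\<alpha>, \<gamma>) \<in> arcs_ends (digr \<Gamma>)"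
  shows "\<exists>\<delta> m k. (\<beta>, \<delta>) \<in> arcs_ends (digr \<Gamma>) ^^ m \<and> (\<gamma>, \<delta>) \<in> arcs_ends (digr \<Gamma>) ^^ k \<and>
    (even m \<longleftrightarrow> even k)"
proof -
  let ?V = "vertices \<Gamma>" and ?E = "arcs_ends (digr \<Gamma>)" and ?M = "\<lambda>s. edge_matrix \<Gamma> s (0::rat)"
  obtain s where s: "s \<in> S" "\<alpha> \<in> ?V" "outgoing \<Gamma> s \<alpha>" "\<beta> = partner \<Gamma> s \<alpha>"
    using arc_outgoing[OF lab arcs(1)] .
  obtain t where t: "t \<in> S" "outgoing \<Gamma> t \<alpha>" "\<gamma> = partner \<Gamma> t \<alpha>"
    using arc_outgoing[OF lab arcs(2)] .
  show ?thesis
  proof (cases "s = t")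
    case True
    then show ?thesis using s t by (intro exI[of _ \<beta>] exI[of _ 0]) simp
  next
    case False
    obtain k where
      k: "prod_list (map T (alt_word (Suc k) s t)) = prod_list (map T (alt_word (Suc k) t s))"
      using braid_relation[OF s(1) t(1) False] fin s t by blast
    have sub: "set (alt_word i s t) \<subseteq> S" "set (alt_word i t s) \<subseteq> S" for i
      using s t set_alt_word[of i s t] set_alt_word[of i t s] by auto
    have wm: "R (prod_list (map T ss)) i j = word_matrix ?V (\<lambda>s. edge_matrix \<Gamma> s u) ss i j"
      if "set ss \<subseteq> S" "i \<in> ?V" "j \<in> ?V" for ss i j
      using word_matrix_representation[OF R that(2,3), of T ss] that gen
        word_matrix_cong[of ss ?V "\<lambda>s. R (T s)" "\<lambda>s. edge_matrix \<Gamma> s u" i j] by auto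
    have "word_matrix ?V (\<lambda>s. edge_matrix \<Gamma> s u) (alt_word (Suc k) s t) i \<alpha> =
        word_matrix ?V (\<lambda>s. edge_matrix \<Gamma> s u) (alt_word (Suc k) t s) i \<alpha>" if "i \<in> ?V" for i
      using wm[OF sub(1) that s(2), of "Suc k"] wm[OF sub(2) that s(2), of "Suc k"] k by simp
    then have braid: "word_matrix ?V ?M (alt_word (Suc k) s t) i \<alpha> =
        word_matrix ?V ?M (alt_word (Suc k) t s) i \<alpha>" if "i \<in> ?V" for i
      using that by (intro word_matrix_specialize)
    \<comment> \<open>Which of the two words ends in \<open>s\<close> depends on the parity of \<open>k\<close>.\<close>
    define ps where "ps = (if even k then alt_word k s t else alt_word k t s)"
    define qs where "qs = (if even k then alt_word k t s else alt_word k s t)"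
    have pq: "set ps \<subseteq> S" "set qs \<subseteq> S" "length ps = k" "length qs = k"
      using sub by (auto simp: ps_def qs_def)
    have eq: "word_matrix ?V ?M (ps @ [s]) i \<alpha> = word_matrix ?V ?M (qs @ [t]) i \<alpha>" if "i \<in> ?V" for i
      using braid[OF that] unfolding alt_word_Suc_right ps_def qs_def by (auto split: if_splits)
    have \<beta>\<gamma>: "\<beta> \<in> ?V" "\<gamma> \<in> ?V"
      using partner_in_vertices[OF lab] s t by auto
    obtain \<omega> m where \<omega>: "\<omega> \<in> ?V" "m \<le> k" "(\<beta>, \<omega>) \<in> ?E ^^ m"
      "\<And>i. word_matrix ?V ?M ps i \<beta> = (if i = \<omega> then (- 1) ^ (k - m) else 0)"
      using word_matrix_zero[OF lab finV pq(1) \<beta>\<gamma>(1)] pq(3) by auto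
    obtain \<omega>' m' where \<omega>': "m' \<le> k" "(\<gamma>, \<omega>') \<in> ?E ^^ m'"
      "\<And>i. word_matrix ?V ?M qs i \<gamma> = (if i = \<omega>' then (- 1) ^ (k - m') else 0)"
      using word_matrix_zero[OF lab finV pq(2) \<beta>\<gamma>(2)] pq(4) by auto
    have "(- 1 :: rat) ^ (k - m) = (if \<omega> = \<omega>' then (- 1) ^ (k - m') else 0)"
      using eq[OF \<omega>(1)] \<omega>(4)[of \<omega>] \<omega>'(3)[of \<omega>] s t
        word_matrix_zero_snoc[OF lab finV s(1) \<omega>(1) s(2,3), of ps]
        word_matrix_zero_snoc[OF lab finV t(1) \<omega>(1) s(2) t(2), of qs]
      by simp
    then have "\<omega> = \<omega>'" and "(- 1 :: rat) ^ (k - m) = (- 1) ^ (k - m')"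
      by (auto split: if_splits)
    then have "even (k - m) \<longleftrightarrow> even (k - m')"
      by (auto simp: minus_one_power_iff split: if_splits)
    then have "even m \<longleftrightarrow> even m'" using \<omega>(2) \<omega>'(1) by auto
    then show ?thesis using \<omega>(3) \<omega>'(2) \<open>\<omega> = \<omega>'\<close> by blast
  qed
qed

lemma sign_function:
  fixes \<Gamma> :: "('w, 'v, 'e) labeled_digraph"
  assumes lab: "S_labeled_digraph S \<Gamma>" and finV: "finite (vertices \<Gamma>)"
    and "matrix_representation scale (vertices \<Gamma>) R"
    and "\<And>s i j. s \<in> S \<Longrightarrow> i \<in> vertices \<Gamma> \<Longrightarrow> j \<in> vertices \<Gamma> \<Longrightarrow> R (T s) i j = edge_matrix \<Gamma> s u i j"
    and "\<forall>s\<in>S. \<forall>t\<in>S. n s t < \<infinity>" and "acyclic_digraph \<Gamma>"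
  obtains D :: "'v \<Rightarrow> ratfun" where "\<And>\<alpha>. D \<alpha> * D \<alpha> = 1"
    and "\<And>s \<alpha>. s \<in> S \<Longrightarrow> \<alpha> \<in> vertices \<Gamma> \<Longrightarrow> D (partner \<Gamma> s \<alpha>) = - D \<alpha>"
proof -
  let ?E = "arcs_ends (digr \<Gamma>)"
  interpret loopfree_digraph "digr \<Gamma>"
    using lab unfolding S_labeled_digraph_def by blast
  have "?E \<subseteq> vertices \<Gamma> \<times> vertices \<Gamma>" by (auto simp: arcs_ends_conv)
  then have "finite ?E" using finV by (meson finite_SigmaI finite_subset)
  then have "wf (?E\<inverse>)"
    using acyclic_arcs_ends[OF wf_digraph assms(6)] by (rule finite_acyclic_wf_converse)
  then have "\<exists>f. \<forall>(a, b)\<in>?E. f a \<longleftrightarrow> \<not> f b"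
    by (rule parity_grading) (rule local_confluence[OF assms(1-5)])
  then obtain f where f: "\<And>a b. (a, b) \<in> ?E \<Longrightarrow> f a \<longleftrightarrow> \<not> f b" by blast
  define D :: "'v \<Rightarrow> ratfun" where "D \<alpha> = (if f \<alpha> then 1 else - 1)" for \<alpha>
  have "D (partner \<Gamma> s \<alpha>) = - D \<alpha>" if "s \<in> S" "\<alpha> \<in> vertices \<Gamma>" for s \<alpha>
  proof (cases "outgoing \<Gamma> s \<alpha>")
    case True
    then show ?thesis using f[OF outgoing_arc[OF lab that True]] by (simp add: D_def)
  next
    case False
    then have "(partner \<Gamma> s \<alpha>, \<alpha>) \<in> ?E"
      using outgoing_arc[OF lab that(1) partner_in_vertices[OF lab that]]
        outgoing_partner[OF lab that] partner_partner[OF lab that] by simp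
    then show ?thesis using f[of "partner \<Gamma> s \<alpha>" \<alpha>] by (simp add: D_def)
  qed
  then show thesis using that[of D] by (simp add: D_def)
qed

end

section \<open>Inverses of the standard basis elements\<close>

lemma ring_inverse_eqI: "x * y = 1 \<Longrightarrow> y * x = 1 \<Longrightarrow> ring_inverse x = y"
  unfolding ring_inverse_def by (rule the_equality) (auto, metis mult.assoc mult_1_left mult_1_right)

definition ring_unit :: "'h::ring_1 \<Rightarrow> bool" where
  "ring_unit x \<longleftrightarrow> (\<exists>y. x * y = 1 \<and> y * x = 1)"

lemma ring_unit_inverse:
  assumes "ring_unit x" shows "x * ring_inverse x = 1" "ring_inverse x * x = 1"
  using assms ring_inverse_eqI unfolding ring_unit_def by metis+

lemma ring_unit_mult:
  assumes "ring_unit x" "ring_unit y"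
  shows "ring_unit (x * y)" "ring_inverse (x * y) = ring_inverse y * ring_inverse x"
proof -
  have "x * y * (ring_inverse y * ring_inverse x) = x * (y * ring_inverse y) * ring_inverse x"
    by (simp only: mult.assoc)
  then have 1: "x * y * (ring_inverse y * ring_inverse x) = 1"
    using assms by (simp add: ring_unit_inverse)
  have "ring_inverse y * ring_inverse x * (x * y) = ring_inverse y * (ring_inverse x * x) * y"
    by (simp only: mult.assoc)
  then have 2: "ring_inverse y * ring_inverse x * (x * y) = 1"
    using assms by (simp add: ring_unit_inverse)
  show "ring_unit (x * y)" using 1 2 unfolding ring_unit_def by blast
  show "ring_inverse (x * y) = ring_inverse y * ring_inverse x" using 1 2 by (rule ring_inverse_eqI)
qed

context coxeter_hecke
begin

lemma generator_inverse:
  assumes "s \<in> S"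
  shows "ring_unit (T s)"
    and "ring_inverse (T s) = scale (1 / u\<^sup>2) (T s) + scale (1 / u\<^sup>2 - 1) 1"
proof -
  define y where "y = scale (1 / u\<^sup>2) (T s) + scale (1 / u\<^sup>2 - 1) 1"
  have c: "1 / u\<^sup>2 * u\<^sup>2 = 1" using u_not_0 by simp
  have d: "1 / u\<^sup>2 * (u\<^sup>2 - 1) + (1 / u\<^sup>2 - 1) = 0" using u_not_0 by (simp add: field_simps)
  have "scale (1 / u\<^sup>2) (T s * T s) + scale (1 / u\<^sup>2 - 1) (T s) =
      scale (1 / u\<^sup>2 * u\<^sup>2) 1 + scale (1 / u\<^sup>2 * (u\<^sup>2 - 1) + (1 / u\<^sup>2 - 1)) (T s)"
    by (simp only: T_quadratic[OF assms] scale_right_distrib scale_scale scale_left_distrib add.assoc)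
  also have "\<dots> = 1" by (simp only: c d scale_one scale_zero_left add_0_right)
  finally have "T s * y = 1" "y * T s = 1"
    by (simp_all only: y_def distrib_left distrib_right scale_mult_left scale_mult_right
        mult_1_left mult_1_right)
  then show "ring_unit (T s)" "ring_inverse (T s) = y"
    unfolding ring_unit_def using ring_inverse_eqI by blast+
qed

lemma T_unit: "w \<in> carrier W \<Longrightarrow> ring_unit (T w)"
proof (induction rule: carrier_induct)
  case one
  show ?case unfolding ring_unit_def T_one by (intro exI[of _ 1]) simp
next
  case (step s w)
  then have "T (s \<otimes>\<^bsub>W\<^esub> w) = T s * T w" using T_mult_longer by simp
  then show ?case using step generator_inverse(1) ring_unit_mult(1) by metis
qed

lemma generator_inverse_quadratic:
  assumes "s \<in> S"
  shows "ring_inverse (T s) * ring_inverse (T s) =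
    scale (1 / u\<^sup>2) 1 + scale (1 / u\<^sup>2 - 1) (ring_inverse (T s))"
proof -
  define z where "z = ring_inverse (T s)"
  have "z * z = z * (scale (1 / u\<^sup>2) (T s) + scale (1 / u\<^sup>2 - 1) 1)"
    using generator_inverse(2)[OF assms] by (simp add: z_def)
  also have "\<dots> = scale (1 / u\<^sup>2) (z * T s) + scale (1 / u\<^sup>2 - 1) z"
    by (simp only: distrib_left scale_mult_right mult_1_right)
  also have "z * T s = 1"
    using ring_unit_inverse(2) generator_inverse(1)[OF assms] by (simp add: z_def)
  finally show ?thesis by (simp add: z_def)
qed

lemma inverse_longer:
  assumes "s \<in> S" "w \<in> carrier W" "len (s \<otimes>\<^bsub>W\<^esub> w) = Suc (len w)"
  shows "ring_inverse (T (s \<otimes>\<^bsub>W\<^esub> w)) = ring_inverse (T w) * ring_inverse (T s)"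
  using T_mult_longer[OF assms(1,2)] assms
    ring_unit_mult(2)[OF generator_inverse(1)[OF assms(1)] T_unit[OF assms(2)]] by simp

text \<open>
  Inverting both the group element and the basis element restores the order of the factors.
\<close>

lemma inverse_longer_flip:
  assumes "s \<in> S" "w \<in> carrier W" "len (s \<otimes>\<^bsub>W\<^esub> w) = Suc (len w)"
  shows "ring_inverse (T (inv\<^bsub>W\<^esub> (s \<otimes>\<^bsub>W\<^esub> w))) =
    ring_inverse (T s) * ring_inverse (T (inv\<^bsub>W\<^esub> w))"
proof -
  have c: "s \<in> carrier W" "inv\<^bsub>W\<^esub> w \<in> carrier W" using assms S_carrier by auto
  have i: "inv\<^bsub>W\<^esub> (s \<otimes>\<^bsub>W\<^esub> w) = inv\<^bsub>W\<^esub> w \<otimes>\<^bsub>W\<^esub> s"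
    using assms c by (simp add: grp.inv_mult_group generator_inv)
  have "len (inv\<^bsub>W\<^esub> w \<otimes>\<^bsub>W\<^esub> s) = Suc (len (inv\<^bsub>W\<^esub> w))"
    using assms c len_inv[of "s \<otimes>\<^bsub>W\<^esub> w"] len_inv[of w] i by simp
  then have "T (inv\<^bsub>W\<^esub> (s \<otimes>\<^bsub>W\<^esub> w)) = T (inv\<^bsub>W\<^esub> w) * T s"
    using T_mult_right[OF c(2) assms(1)] i by simp
  then show ?thesis
    using ring_unit_mult(2)[OF T_unit[OF c(2)] generator_inverse(1)[OF assms(1)]] by simp
qed

lemma inverse_one: "ring_inverse (T \<one>\<^bsub>W\<^esub>) = 1"
  unfolding T_one by (rule ring_inverse_eqI) simp_all

text \<open>
  A family obeying the rules of the Hecke algebra yields a homomorphism. Applied to the reversed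
  digraph, this shows at once that it is a \<open>W\<close>-digraph and what its character is.
\<close>

lemma chi_of_matrix_family:
  fixes \<Gamma> :: "('w, 'v, 'e) labeled_digraph"
  assumes fin: "finite (vertices \<Gamma>)" and lab: "S_labeled_digraph S \<Gamma>"
    and one: "\<And>i j. i \<in> vertices \<Gamma> \<Longrightarrow> j \<in> vertices \<Gamma> \<Longrightarrow> Q \<one>\<^bsub>W\<^esub> i j = mat_one i j"
    and step: "\<And>s w i j. s \<in> S \<Longrightarrow> w \<in> carrier W \<Longrightarrow> len (s \<otimes>\<^bsub>W\<^esub> w) = Suc (len w) \<Longrightarrow>
        i \<in> vertices \<Gamma> \<Longrightarrow> j \<in> vertices \<Gamma> \<Longrightarrow> Q (s \<otimes>\<^bsub>W\<^esub> w) i j = mat_mult (vertices \<Gamma>) (Q s) (Q w) i j"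
    and quad: "\<And>s i j. s \<in> S \<Longrightarrow> i \<in> vertices \<Gamma> \<Longrightarrow> j \<in> vertices \<Gamma> \<Longrightarrow>
        mat_mult (vertices \<Gamma>) (Q s) (Q s) i j = u\<^sup>2 * mat_one i j + (u\<^sup>2 - 1) * Q s i j"
    and gen: "\<And>s i j. s \<in> S \<Longrightarrow> i \<in> vertices \<Gamma> \<Longrightarrow> j \<in> vertices \<Gamma> \<Longrightarrow> Q s i j = edge_matrix \<Gamma> s u i j"
    and w: "w \<in> carrier W"
  shows "chi scale S T \<Gamma> (T w) = (\<Sum>i\<in>vertices \<Gamma>. Q w i i)"
proof -
  obtain R where R: "matrix_representation scale (vertices \<Gamma>) R"
    and RT: "\<And>w. w \<in> carrier W \<Longrightarrow> R (T w) = Q w"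
    using matrix_representation_exists[OF fin one step quad] by blast
  show ?thesis
    using chi_eq_matrix_trace[OF fin lab R] RT[OF w] RT gen S_carrier by simp
qed


section \<open>Characters of the reversed digraph\<close>

context
  fixes \<Gamma> :: "('w, 'v, 'e) labeled_digraph" and R :: "'h \<Rightarrow> 'v \<Rightarrow> 'v \<Rightarrow> ratfun"
  assumes fin: "finite (vertices \<Gamma>)" and lab: "S_labeled_digraph S \<Gamma>"
    and R: "matrix_representation scale (vertices \<Gamma>) R"
    and gen: "\<And>s i j. s \<in> S \<Longrightarrow> i \<in> vertices \<Gamma> \<Longrightarrow> j \<in> vertices \<Gamma> \<Longrightarrow> R (T s) i j = edge_matrix \<Gamma> s u i j"
begin

lemma chi_trace: "chi scale S T \<Gamma> a = (\<Sum>i\<in>vertices \<Gamma>. R a i i)"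
  by (rule chi_eq_matrix_trace[OF fin lab R]) (rule gen)

lemma representation_generator_inverse:
  assumes "s \<in> S" "i \<in> vertices \<Gamma>" "j \<in> vertices \<Gamma>"
  shows "R (ring_inverse (T s)) i j =
    1 / u\<^sup>2 * edge_matrix \<Gamma> s u i j + (1 / u\<^sup>2 - 1) * mat_one i j"
  unfolding generator_inverse(2)[OF assms(1)]
  using assms by (simp add: matrix_representationD[OF R] gen)

lemma representation_inverse_square:
  assumes "s \<in> S" "i \<in> vertices \<Gamma>" "j \<in> vertices \<Gamma>"
  shows "mat_mult (vertices \<Gamma>) (R (ring_inverse (T s))) (R (ring_inverse (T s))) i j =
    1 / u\<^sup>2 * mat_one i j + (1 / u\<^sup>2 - 1) * R (ring_inverse (T s)) i j"
proof -
  note D = matrix_representationD[OF R assms(2,3)]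
  have "mat_mult (vertices \<Gamma>) (R (ring_inverse (T s))) (R (ring_inverse (T s))) i j =
      R (scale (1 / u\<^sup>2) 1 + scale (1 / u\<^sup>2 - 1) (ring_inverse (T s))) i j"
    unfolding generator_inverse_quadratic[OF assms(1), symmetric] D(4) ..
  then show ?thesis by (simp only: D(1-3))
qed

text \<open>
  Applying \<open>\<sigma>\<close> entrywise to the matrices of the elements \<open>T\<^bsub>w\<^sup>-\<^sup>1\<^esub>\<^sup>-\<^sup>1\<close> gives a family that is
  multiplicative in the same order as the basis, and that agrees on generators with the reversed
  digraph.
\<close>

lemma chi_rev_sigma:
  assumes "field_automorphism \<sigma>" and \<sigma>u: "\<sigma> u = - 1 / u" and w: "w \<in> carrier W"
  shows "chi scale S T (rev_digraph \<Gamma>) (T w) =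
    \<sigma> (chi scale S T \<Gamma> (ring_inverse (T (inv\<^bsub>W\<^esub> w))))"
proof -
  interpret \<sigma>: comm_ring_map \<sigma>
    using assms(1) unfolding field_automorphism_def by unfold_locales auto
  have \<sigma>c: "\<sigma> (1 / u\<^sup>2) = u\<^sup>2"
  proof -
    have "\<sigma> (1 / u\<^sup>2) * \<sigma> (u\<^sup>2) = 1"
      using u_not_0 by (simp add: \<sigma>.map_mult[symmetric] \<sigma>.map_one)
    moreover have "\<sigma> (u\<^sup>2) = 1 / u\<^sup>2"
      by (simp add: \<sigma>.map_power \<sigma>u power_divide)
    ultimately show ?thesis using u_not_0 by simp
  qed
  define Q where "Q w i j = \<sigma> (R (ring_inverse (T (inv\<^bsub>W\<^esub> w))) i j)" for w i j
  note V = rev_vertices[of \<Gamma>]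
  have Qs: "Q s i j = \<sigma> (R (ring_inverse (T s)) i j)" if "s \<in> S" for s i j
    using that by (simp add: Q_def generator_inv)
  have "chi scale S T (rev_digraph \<Gamma>) (T w) = (\<Sum>i\<in>vertices (rev_digraph \<Gamma>). Q w i i)"
  proof (rule chi_of_matrix_family[where Q = Q])
    show "finite (vertices (rev_digraph \<Gamma>))" "S_labeled_digraph S (rev_digraph \<Gamma>)" "w \<in> carrier W"
      using fin rev_labeled[OF lab] w by (simp_all add: V)
  next
    fix i j assume "i \<in> vertices (rev_digraph \<Gamma>)" "j \<in> vertices (rev_digraph \<Gamma>)"
    then show "Q \<one>\<^bsub>W\<^esub> i j = mat_one i j"
      using matrix_representationD(3)[OF R, of i j]
      by (simp add: Q_def V inverse_one \<sigma>.map_mat_one)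
  next
    fix s x i j
    assume s: "s \<in> S" "x \<in> carrier W" "len (s \<otimes>\<^bsub>W\<^esub> x) = Suc (len x)"
      and ij: "i \<in> vertices (rev_digraph \<Gamma>)" "j \<in> vertices (rev_digraph \<Gamma>)"
    show "Q (s \<otimes>\<^bsub>W\<^esub> x) i j = mat_mult (vertices (rev_digraph \<Gamma>)) (Q s) (Q x) i j"
      using ij matrix_representationD(4)[OF R, of i j] unfolding V
      by (simp add: Q_def inverse_longer_flip[OF s] generator_inv[OF s(1)] mat_mult_def
          \<sigma>.map_sum \<sigma>.map_mult)
  next
    fix s i j
    assume s: "s \<in> S" and ij: "i \<in> vertices (rev_digraph \<Gamma>)" "j \<in> vertices (rev_digraph \<Gamma>)"
    have "mat_mult (vertices \<Gamma>) (Q s) (Q s) i j =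
        \<sigma> (mat_mult (vertices \<Gamma>) (R (ring_inverse (T s))) (R (ring_inverse (T s))) i j)"
      by (simp add: Qs[OF s] mat_mult_def \<sigma>.map_sum \<sigma>.map_mult)
    then show "mat_mult (vertices (rev_digraph \<Gamma>)) (Q s) (Q s) i j =
        u\<^sup>2 * mat_one i j + (u\<^sup>2 - 1) * Q s i j"
      using ij unfolding V
      by (simp only: representation_inverse_square[OF s] \<sigma>.map_add \<sigma>.map_mult \<sigma>.map_diff
          \<sigma>.map_one \<sigma>.map_mat_one \<sigma>c Qs[OF s])
    show "Q s i j = edge_matrix (rev_digraph \<Gamma>) s u i j"
      using ij unfolding V Qs[OF s] rev_edge_matrix_sigma[OF lab s ij(2)[unfolded V] u_not_0]
      by (simp only: representation_generator_inverse[OF s] \<sigma>.map_add \<sigma>.map_mult \<sigma>.map_diff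
          \<sigma>.map_one \<sigma>.map_mat_one \<sigma>.map_edge_matrix \<sigma>c \<sigma>u)
  qed
  also have "\<dots> = \<sigma> (chi scale S T \<Gamma> (ring_inverse (T (inv\<^bsub>W\<^esub> w))))"
    unfolding V chi_trace \<sigma>.map_sum by (simp add: Q_def)
  finally show ?thesis .
qed

text \<open>
  Transposition reverses the order of products, which is why the plain inverses occur here in
  place of the \<open>T\<^bsub>w\<^sup>-\<^sup>1\<^esub>\<^sup>-\<^sup>1\<close>.
\<close>

lemma chi_rev_sign:
  fixes D :: "'v \<Rightarrow> ratfun"
  assumes D: "\<And>\<alpha>. D \<alpha> * D \<alpha> = 1"
    "\<And>s \<alpha>. s \<in> S \<Longrightarrow> \<alpha> \<in> vertices \<Gamma> \<Longrightarrow> D (partner \<Gamma> s \<alpha>) = - D \<alpha>"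
    and w: "w \<in> carrier W"
  shows "chi scale S T (rev_digraph \<Gamma>) (T w) =
    (- 1) ^ len w * u ^ (2 * len w) * chi scale S T \<Gamma> (ring_inverse (T w))"
proof -
  define Q where "Q w i j = (- (u\<^sup>2)) ^ len w * (D i * D j * R (ring_inverse (T w)) j i)" for w i j
  note V = rev_vertices[of \<Gamma>]
  have Qs: "Q s i j = - (u\<^sup>2) * (D i * D j * R (ring_inverse (T s)) j i)" if "s \<in> S" for s i j
    using that by (simp add: Q_def len_generator)
  \<comment> \<open>The signs at the intermediate vertex cancel, and the transposed factors change places.\<close>
  have mult: "(\<Sum>k\<in>vertices \<Gamma>. a * (D i * D k * A k i) * (b * (D k * D j * B j k))) =
      a * b * (D i * D j * mat_mult (vertices \<Gamma>) B A j i)" for a b A B i j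
  proof -
    have "a * (D i * D k * A k i) * (b * (D k * D j * B j k)) = a * b * (D i * D j * (B j k * A k i))" for k
    proof -
      have "a * (D i * D k * A k i) * (b * (D k * D j * B j k)) =
          a * b * (D i * D j * (B j k * A k i)) * (D k * D k)"
        by (simp only: mult_ac)
      then show ?thesis by (simp add: D(1))
    qed
    then show ?thesis by (simp only: mat_mult_def sum_distrib_left)
  qed
  have "chi scale S T (rev_digraph \<Gamma>) (T w) = (\<Sum>i\<in>vertices (rev_digraph \<Gamma>). Q w i i)"
  proof (rule chi_of_matrix_family[where Q = Q])
    show "finite (vertices (rev_digraph \<Gamma>))" "S_labeled_digraph S (rev_digraph \<Gamma>)" "w \<in> carrier W"
      using fin rev_labeled[OF lab] w by (simp_all add: V)
  next
    fix i j assume "i \<in> vertices (rev_digraph \<Gamma>)" "j \<in> vertices (rev_digraph \<Gamma>)"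
    then show "Q \<one>\<^bsub>W\<^esub> i j = mat_one i j"
      using matrix_representationD(3)[OF R, of j i] D(1)
      by (simp add: Q_def V inverse_one len_one mat_one_def)
  next
    fix s x i j
    assume s: "s \<in> S" "x \<in> carrier W" "len (s \<otimes>\<^bsub>W\<^esub> x) = Suc (len x)"
      and ij: "i \<in> vertices (rev_digraph \<Gamma>)" "j \<in> vertices (rev_digraph \<Gamma>)"
    have "mat_mult (vertices \<Gamma>) (Q s) (Q x) i j = - (u\<^sup>2) * (- (u\<^sup>2)) ^ len x *
        (D i * D j * mat_mult (vertices \<Gamma>) (R (ring_inverse (T x))) (R (ring_inverse (T s))) j i)"
      unfolding mat_mult_def[of _ "Q s"] Qs[OF s(1)] Q_def[of x] by (rule mult)
    then show "Q (s \<otimes>\<^bsub>W\<^esub> x) i j = mat_mult (vertices (rev_digraph \<Gamma>)) (Q s) (Q x) i j"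
      using ij matrix_representationD(4)[OF R, of j i] unfolding V
      by (simp add: Q_def[of "s \<otimes>\<^bsub>W\<^esub> x"] inverse_longer[OF s] s(3))
  next
    fix s i j
    assume s: "s \<in> S" and ij: "i \<in> vertices (rev_digraph \<Gamma>)" "j \<in> vertices (rev_digraph \<Gamma>)"
    note ji = ij(2,1)[unfolded V]
    have one: "D i * D j * mat_one j i = mat_one i j"
      using D(1) by (simp add: mat_one_def)
    have c: "- (u\<^sup>2) * - (u\<^sup>2) * (D i * D j * (1 / u\<^sup>2 * m + (1 / u\<^sup>2 - 1) * r)) =
        u\<^sup>2 * (D i * D j * m) + (u\<^sup>2 - 1) * (- (u\<^sup>2) * (D i * D j * r))" for m r
      using u_not_0 by (simp add: field_simps)
    have "mat_mult (vertices \<Gamma>) (Q s) (Q s) i j = - (u\<^sup>2) * - (u\<^sup>2) *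
        (D i * D j * mat_mult (vertices \<Gamma>) (R (ring_inverse (T s))) (R (ring_inverse (T s))) j i)"
      unfolding mat_mult_def[of _ "Q s"] Qs[OF s] by (rule mult)
    then show "mat_mult (vertices (rev_digraph \<Gamma>)) (Q s) (Q s) i j =
        u\<^sup>2 * mat_one i j + (u\<^sup>2 - 1) * Q s i j"
      unfolding V representation_inverse_square[OF s ji] c one Qs[OF s] .
    have "- (u\<^sup>2) * (D i * D j * (1 / u\<^sup>2 * e + (1 / u\<^sup>2 - 1) * m)) =
        (u\<^sup>2 - 1) * (D i * D j * m) - D i * D j * e" for e m
      using u_not_0 by (simp add: field_simps)
    then have "Q s i j = (u\<^sup>2 - 1) * (D i * D j * mat_one j i) - D i * D j * edge_matrix \<Gamma> s u j i"
      unfolding Qs[OF s] representation_generator_inverse[OF s ji] .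
    also have "\<dots> = D i * D j * ((u\<^sup>2 - 1) * mat_one i j - edge_matrix \<Gamma> s u j i)"
      by (simp add: mat_one_def algebra_simps)
    also have "\<dots> = edge_matrix (rev_digraph \<Gamma>) s u i j"
      using rev_edge_matrix_transpose[OF lab s ji(2,1), of D u] D s by simp
    finally show "Q s i j = edge_matrix (rev_digraph \<Gamma>) s u i j" .
  qed
  also have "\<dots> = (- (u\<^sup>2)) ^ len w * (\<Sum>i\<in>vertices \<Gamma>. R (ring_inverse (T w)) i i)"
    unfolding V by (simp add: Q_def D(1) sum_distrib_left)
  also have "(- (u\<^sup>2)) ^ len w = (- 1) ^ len w * u ^ (2 * len w)"
    by (simp add: power_mult power_minus[of "u\<^sup>2"])
  also have "(\<Sum>i\<in>vertices \<Gamma>. R (ring_inverse (T w)) i i) = chi scale S T \<Gamma> (ring_inverse (T w))"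
    by (simp only: chi_trace)
  finally show ?thesis .
qed

end

end

theorem theorem1p11:
  fixes W :: "('w, 'm) monoid_scheme" and S :: "'w set" and n :: "'w \<Rightarrow> 'w \<Rightarrow> enat"
    and scale :: "ratfun \<Rightarrow> 'h::ring_1 \<Rightarrow> 'h" and T :: "'w \<Rightarrow> 'h"
    and \<Gamma> :: "('w, 'v, 'e) labeled_digraph"
  assumes "coxeter_system W S n"
    and "hecke_algebra scale W S T"
    and "W_digraph scale S T \<Gamma>"
    and "finite (vertices \<Gamma>)"
  shows "(\<forall>\<sigma>. field_automorphism \<sigma> \<and> \<sigma> u = - 1 / u \<longrightarrow>
            (\<forall>w\<in>carrier W.
               chi scale S T (rev_digraph \<Gamma>) (T w) =
               \<sigma> (chi scale S T \<Gamma> (ring_inverse (T (inv\<^bsub>W\<^esub> w)))))) \<and>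
         ((\<forall>s\<in>S. \<forall>t\<in>S. n s t < \<infinity>) \<and> acyclic_digraph \<Gamma> \<longrightarrow>
            (\<forall>w\<in>carrier W.
               chi scale S T (rev_digraph \<Gamma>) (T w) =
               (- 1) ^ coxeter_length W S w * u ^ (2 * coxeter_length W S w) *
               chi scale S T \<Gamma> (ring_inverse (T w))))"
proof -
  interpret hecke_algebra scale W S T by fact
  interpret coxeter_hecke scale W S T n
    by unfold_locales (rule assms(1))
  obtain \<rho> where lab: "S_labeled_digraph S \<Gamma>" and \<rho>: "extends_tau scale S T \<Gamma> \<rho>"
    using assms(3) unfolding W_digraph_def by blast
  define R where "R a = operator_matrix (\<rho> a)" for a
  have R: "matrix_representation scale (vertices \<Gamma>) R"
    and gen: "\<And>s i j. s \<in> S \<Longrightarrow> i \<in> vertices \<Gamma> \<Longrightarrow> j \<in> vertices \<Gamma> \<Longrightarrow> R (T s) i j = edge_matrix \<Gamma> s u i j"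
    unfolding R_def using matrix_representation_of_extends_tau[OF assms(4) lab \<rho>] by blast+
  show ?thesis
  proof (intro conjI allI impI ballI; elim conjE)
    fix \<sigma> w assume "field_automorphism \<sigma>" "\<sigma> u = - 1 / u" "w \<in> carrier W"
    then show "chi scale S T (rev_digraph \<Gamma>) (T w) =
        \<sigma> (chi scale S T \<Gamma> (ring_inverse (T (inv\<^bsub>W\<^esub> w))))"
      using chi_rev_sigma[OF assms(4) lab R gen] by blast
  next
    fix w assume "\<forall>s\<in>S. \<forall>t\<in>S. n s t < \<infinity>" "acyclic_digraph \<Gamma>" and w: "w \<in> carrier W"
    then obtain D :: "'v \<Rightarrow> ratfun" where D: "\<And>\<alpha>. D \<alpha> * D \<alpha> = 1"
      "\<And>s \<alpha>. s \<in> S \<Longrightarrow> \<alpha> \<in> vertices \<Gamma> \<Longrightarrow> D (partner \<Gamma> s \<alpha>) = - D \<alpha>"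
      using sign_function[OF lab assms(4) R gen] by blast
    show "chi scale S T (rev_digraph \<Gamma>) (T w) =
        (- 1) ^ coxeter_length W S w * u ^ (2 * coxeter_length W S w) *
        chi scale S T \<Gamma> (ring_inverse (T w))"
      using chi_rev_sign[OF assms(4) lab R gen _ _ w, of D] D by blast
  qed
qed

end
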